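(* (i) For every integer $n\ge 0$, the following identity holds in $\mathbb{Q}(x)$, where $x$ is an indeterminate: $$\begin{aligned}H_{n}\left(\frac{B_{2k+5}\left(\frac{x+1}{2}\right)}{2k+5}\right)=&\ \frac{1}{5\cdot 2^{n+2}}\prod_{i=1}^{n}\frac{(2i+3)!^{2}\,(2i+2)!^{2}}{(4i+5)!\,(4i+4)!}\ \prod_{\ell=0}^{n}(x-2n-1+2\ell)_{4n-4\ell+3}\\ &\times\sum_{i=1}^{n+2}\frac{(2i-1)\left(n+\frac{5}{2}\right)_{i-1}\left(\frac{x}{2}+\frac{1}{2}\right)_{n+2}\left(\frac{x}{2}-n-\frac{3}{2}\right)_{n+2}}{\left(n-i+\frac{5}{2}\right)_{i}\,(n+2-i)!\,(n+1+i)!\,\left(x^{2}-(2i-1)^{2}\right)}.\end{aligned}$$ (ii) For all integers $n\ge 0$ and $r\ge 1$, $$\begin{aligned}\det V_{n}=&\ 2^{2n^{2}-2n-1}\prod_{i=1}^{n}\frac{(2i)!^{4}}{(4i)!\,(4i+1)!}\ \prod_{\ell=0}^{n}(r-\ell)_{2\ell+1}\ \prod_{\ell=0}^{n-1}\left(r+\tfrac{1}{2}-\ell\right)_{2\ell+1}\\ &\times\sum_{i=1}^{n+1}\frac{(2n+2i)!\,(2n+2-2i)!\,(r+1)_{n+1}}{(n+i)!^{2}\,(n+1-i)!^{2}\,(r+i)}.\end{aligned}$$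
   Context: $(a)_m=a(a+1)\cdots(a+m-1)$ is the Pochhammer symbol, with $(a)_0=1$. $B_n(x)$ is the $n$th Bernoulli polynomial, defined by $\frac{te^{tx}}{e^t-1}=\sum_{n\ge 0}B_n(x)\frac{t^n}{n!}$. For a sequence $(c_k)_{k\ge 0}$, the Hankel determinant is $H_n(c_k):=\det(c_{i+j})_{0\le i,j\le n}$, the determinant of an $(n+1)\times(n+1)$ matrix; thus $H_n\left(\frac{B_{2k+5}((x+1)/2)}{2k+5}\right)$ is taken with $c_k=\frac{B_{2k+5}((x+1)/2)}{2k+5}$, $k\ge 0$. For a fixed integer $r\ge 1$, put $I_k:=\sum_{c=1}^{r}c^k$ (so $I_0=r$), and let $V_n:=(I_{2i+2j})_{0\le i,j\le n}$, an $(n+1)\times(n+1)$ matrix. Empty products equal $1$. Here $(m)!^2$ means $(m!)^2$, and similarly for other exponents. *)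

theory Defs
  imports
    "HOL-Computational_Algebra.Computational_Algebra"
    "Jordan_Normal_Form.Determinant"
begin

text \<open>
  The quotient is taken in the ring of formal power series; it is exact, since both numerator
  and denominator have order 1 (see \<open>bernpoly_generating_function\<close>). The argument ranges over
  any field of characteristic 0, so it may be a rational number or a rational function.
\<close>
definition bernpoly :: "nat \<Rightarrow> 'a :: field_char_0 \<Rightarrow> 'a" where
  "bernpoly n x = fact n * fps_nth (fps_X * fps_exp x / (fps_exp 1 - 1)) n"

lemma bernpoly_generating_function:
  fixes x :: "'a :: field_char_0"
  shows "Abs_fps (\<lambda>n. bernpoly n x / fact n) * (fps_exp 1 - 1) = fps_X * fps_exp x"
proof -
  have eq: "Abs_fps (\<lambda>n. bernpoly n x / fact n) = fps_X * fps_exp x / (fps_exp 1 - 1)"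
    by (rule fps_ext) (simp add: bernpoly_def)
  have nth1: "fps_nth (fps_exp (1::'a) - 1) 1 \<noteq> 0"
    by simp
  have "subdegree (fps_exp (1::'a) - 1) = 1"
    by (rule subdegreeI) auto
  moreover have "subdegree (fps_X * fps_exp x) = 1"
    by (rule subdegreeI) auto
  moreover have "fps_exp (1::'a) - 1 \<noteq> 0"
    using nth1 by (metis fps_zero_nth)
  ultimately have "(fps_exp 1 - 1) dvd fps_X * fps_exp x"
    by (subst fps_dvd_iff) auto
  then show ?thesis
    unfolding eq by (rule dvd_div_mult_self)
qed

text \<open>Size \<open>n + 1\<close>, with indices \<open>0, \<dots>, n\<close>.\<close>
definition hankel_det :: "nat \<Rightarrow> (nat \<Rightarrow> 'a :: comm_ring_1) \<Rightarrow> 'a" where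
  "hankel_det n c = det (mat (n + 1) (n + 1) (\<lambda>(i, j). c (i + j)))"

definition power_sum :: "nat \<Rightarrow> nat \<Rightarrow> rat" where
  "power_sum r k = (\<Sum>c = 1..r. of_nat c ^ k)"

definition V_mat :: "nat \<Rightarrow> nat \<Rightarrow> rat mat" where
  "V_mat r n = mat (n + 1) (n + 1) (\<lambda>(i, j). power_sum r (2 * i + 2 * j))"

text \<open>The indeterminate \<open>x\<close> of the field of rational functions over the rationals.\<close>
definition ratfun_X :: "rat poly fract" where
  "ratfun_X = to_fract [:0, 1:]"

end

theory Submission
  imports Defs
begin

text \<open>
  For a positive integer \<open>r\<close>, the numbers \<open>I\<^bsub>2k+2\<^esub>\<close> are the moments, in \<open>t = c\<^sup>2\<close>, of the weight
  \<open>c\<^sup>2\<close> on \<open>c = 1, \<dots>, r\<close>. Its orthogonal polynomials \<open>P\<^sub>n\<close> are explicit (Racah polynomials), so the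
  Hankel determinant of \<open>I\<^bsub>2k+2\<^esub>\<close> is a product of norms. Shifting the moments up or down by one index
  multiplies it by \<open>P\<^bsub>n+1\<^esub>(0)\<close> and by the sum of \<open>P\<^sub>n(c\<^sup>2)\<close> over \<open>c \<le> r\<close>, respectively: this handles
  \<open>I\<^bsub>2k+4\<^esub> = B\<^bsub>2k+5\<^esub>(r+1)/(2k+5)\<close> and \<open>I\<^bsub>2k\<^esub>\<close>. Both factors are polynomials in \<open>r\<close>, and
  the sums in the theorem are their Lagrange interpolation formulas at the nodes \<open>0, \<dots>, n\<close> and
  \<open>-1, \<dots>, -n-1\<close>. The identity in the indeterminate \<open>x\<close> holds because it holds at \<open>x = 2r + 1\<close> for all
  large integers \<open>r\<close>.
\<close>

subsection \<open>Polynomial functions and interpolation\<close>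

text \<open>The weight \<open>c^2\<close> ignores \<open>c = 0\<close>, so sums over
  \<open>1..r\<close> are half of sums over \<open>-r..r\<close>, and \<open>c P_n(c^2)\<close> is,
  up to a constant, the discrete Chebyshev polynomial of degree \<open>2n+1\<close> on these equally
  spaced points. This is why \<open>I_(2k+2)\<close>, one shift away from both sequences of the
  theorem, is the one to start from. Orthogonality rests on two product bases:
  \<open>node_poly\<close> vanishes at the smallest nodes, \<open>test_poly\<close> at the largest,
  and the weighted sum of a product of one of each factors completely. Inner products thus become
  alternating binomial sums: an \<open>n\<close>-th difference of a polynomial of degree below
  \<open>n\<close>, or, for the norm, a partial fraction expansion. The obstacle is that
  interpolation in \<open>r\<close> uses \<open>r = 0..n\<close>, where the weight has at most
  \<open>n\<close> atoms and denominators of the hypergeometric series may vanish. Hence the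
  coefficients are normalised to be polynomials in \<open>r\<close>. At these small \<open>r\<close>
  the sums collapse, and the symmetry \<open>r -> -1-r\<close> supplies the negative nodes.\<close>

definition polyfun :: "nat \<Rightarrow> ('a :: field_char_0 \<Rightarrow> 'a) \<Rightarrow> bool" where
  "polyfun d f \<longleftrightarrow> (\<exists>p. degree p \<le> d \<and> (\<forall>x. f x = poly p x))"

lemma polyfun_poly: "degree p \<le> d \<Longrightarrow> polyfun d (poly p)"
  unfolding polyfun_def by auto

lemma polyfun_mono: "polyfun d f \<Longrightarrow> d \<le> d' \<Longrightarrow> polyfun d' f"
  unfolding polyfun_def by (meson le_trans)

lemma polyfun_const: "polyfun d (\<lambda>_. c)"
  unfolding polyfun_def by (rule exI[of _ "[:c:]"]) auto

lemma polyfun_linear: "polyfun 1 (\<lambda>x. a * x + b)"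
  unfolding polyfun_def by (rule exI[of _ "[:b, a:]"]) auto

lemma polyfun_add: "polyfun d f \<Longrightarrow> polyfun d g \<Longrightarrow> polyfun d (\<lambda>x. f x + g x)"
  unfolding polyfun_def by (metis degree_add_le poly_add)

lemma polyfun_mult: "polyfun d f \<Longrightarrow> polyfun e g \<Longrightarrow> polyfun (d + e) (\<lambda>x. f x * g x)"
  unfolding polyfun_def by (metis (no_types, lifting) add_mono degree_mult_le le_trans poly_mult)

lemma polyfun_cmult: "polyfun d f \<Longrightarrow> polyfun d (\<lambda>x. c * f x)"
  using polyfun_mult[OF polyfun_const[of 0 c]] by simp

lemma polyfun_sum: "(\<And>i. i \<in> A \<Longrightarrow> polyfun d (f i)) \<Longrightarrow> polyfun d (\<lambda>x. \<Sum>i\<in>A. f i x)"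
  by (induction A rule: infinite_finite_induct) (auto intro: polyfun_const polyfun_add)

lemma polyfun_prod:
  assumes "\<And>i. i \<in> A \<Longrightarrow> polyfun (d i) (f i)"
  shows "polyfun (sum d A) (\<lambda>x. \<Prod>i\<in>A. f i x)"
  using assms
  by (induction A rule: infinite_finite_induct) (auto intro: polyfun_const polyfun_mult)

lemma polyfun_pochhammer:
  assumes "polyfun 1 f"
  shows "polyfun n (\<lambda>x. pochhammer (f x) n)"
proof -
  have "polyfun (\<Sum>i\<in>{0..<n}. 1) (\<lambda>x. \<Prod>i\<in>{0..<n}. f x + of_nat i)"
    by (rule polyfun_prod) (intro polyfun_add assms polyfun_const)
  then show ?thesis by (simp add: pochhammer_prod)
qed

lemma polyfun_add_const: "polyfun 1 (\<lambda>x. x + a)"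
  and polyfun_const_diff: "polyfun 1 (\<lambda>x. a - x)"
  using polyfun_linear[of 1 a] polyfun_linear[of "-1" a] by (simp_all add: algebra_simps)

lemma polyfun_compose_linear:
  assumes "polyfun d f"
  shows "polyfun d (\<lambda>x. f (a * x + b))"
proof -
  obtain p where p: "degree p \<le> d" "\<And>x. f x = poly p x"
    using assms unfolding polyfun_def by auto
  have "degree (pcompose p [:b, a:]) \<le> d"
    using p(1) degree_pcompose_le[of p "[:b, a:]"]
    by (metis (no_types, lifting) degree_pCons_eq_if degree_0 le_trans mult.right_neutral
        mult_le_mono2 One_nat_def zero_le_one le_refl)
  moreover have "f (a * x + b) = poly (pcompose p [:b, a:]) x" for x
    by (simp add: p poly_pcompose algebra_simps)
  ultimately show ?thesis unfolding polyfun_def by blast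
qed

text \<open>The way in which identities in the free parameters \<open>r\<close>, \<open>u\<close>
  and \<open>y\<close> are proved: bound the degree of both sides and compare them at enough special
  points where the sums collapse.\<close>

lemma polyfun_eqI:
  assumes "polyfun d f" "polyfun d g" "card A > d" "\<And>x. x \<in> A \<Longrightarrow> f x = g x"
  shows "f = g"
proof -
  obtain p q where p: "degree p \<le> d" "\<And>x. f x = poly p x"
    and q: "degree q \<le> d" "\<And>x. g x = poly q x"
    using assms(1,2) unfolding polyfun_def by auto
  have "p = q"
    by (rule poly_eqI_degree[of A]) (use assms(3,4) p q in auto)
  then show ?thesis using p q by auto
qed

section \<open>Lagrange interpolation and alternating binomial sums\<close>

lemma prod_of_nat_diff_except:
  fixes n m :: nat
  assumes "m \<le> n"
  shows "(\<Prod>j\<in>{..n} - {m}. of_nat j - of_nat m :: 'a :: field_char_0) =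
    (-1) ^ m * fact m * fact (n - m)"
proof -
  have "{..n} - {m} = {..<m} \<union> {m<..n}" using assms by auto
  then have "(\<Prod>j\<in>{..n} - {m}. of_nat j - of_nat m :: 'a) =
      (\<Prod>j\<in>{..<m}. of_nat j - of_nat m) * (\<Prod>j\<in>{m<..n}. of_nat j - of_nat m)"
    by (simp add: prod.union_disjoint disjoint_iff)
  also have "(\<Prod>j\<in>{..<m}. of_nat j - of_nat m :: 'a) = (\<Prod>i\<in>{..<m}. - of_nat (Suc i))"
    by (rule prod.reindex_bij_witness[of _ "\<lambda>i. m - Suc i" "\<lambda>j. m - Suc j"])
      (auto simp: of_nat_diff)
  also have "\<dots> = (-1) ^ m * fact m"
    by (simp add: prod_uminus fact_prod_Suc atLeast0LessThan del: of_nat_Suc)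
  also have "(\<Prod>j\<in>{m<..n}. of_nat j - of_nat m :: 'a) = (\<Prod>i\<in>{1..n - m}. of_nat i)"
    using assms by (intro prod.reindex_bij_witness[of _ "\<lambda>i. m + i" "\<lambda>j. j - m"])
      (auto simp: of_nat_diff)
  also have "\<dots> = fact (n - m)"
    by (simp add: fact_prod)
  finally show ?thesis .
qed

text \<open>The nodes for \<open>f\<close> are \<open>0..n\<close>; the argument \<open>- y\<close>
  turns the node factors into \<open>y + of_nat j\<close>. The Lagrange denominator at
  \<open>k\<close> is \<open>(-1)^k k! (n-k)!\<close>, and multiplying by \<open>n!\<close> leaves
  signed binomial coefficients.\<close>

lemma lagrange_interpolation_nat:
  fixes f :: "'a :: field_char_0 \<Rightarrow> 'a"
  assumes "polyfun n f"
  shows "fact n * f (- y) =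
    (\<Sum>k\<le>n. (-1) ^ k * of_nat (n choose k) * f (of_nat k) * (\<Prod>j\<in>{..n} - {k}. y + of_nat j))"
proof -
  let ?g = "\<lambda>y. \<Sum>k\<le>n. ((-1) ^ k * of_nat (n choose k) * f (of_nat k)) *
    (\<Prod>j\<in>{..n} - {k}. y + of_nat j)"
  have "(\<lambda>y. fact n * f (- y)) = ?g"
  proof (rule polyfun_eqI[where d = n and A = "(\<lambda>m. - of_nat m) ` {..n}"])
    show "polyfun n (\<lambda>y. fact n * f (- y))"
      using polyfun_compose_linear[OF assms, of "-1" 0] by (intro polyfun_cmult) simp
    have "polyfun (\<Sum>j\<in>{..n} - {k}. 1) (\<lambda>y. \<Prod>j\<in>{..n} - {k}. y + of_nat j :: 'a)" for k
      by (rule polyfun_prod) (use polyfun_linear[of 1] in simp)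
    note * = polyfun_mono[OF this]
    have "polyfun n (\<lambda>y. \<Prod>j\<in>{..n} - {k}. y + of_nat j :: 'a)" if "k \<le> n" for k
      by (rule *) (use that in simp)
    then show "polyfun n ?g"
      by (intro polyfun_sum polyfun_cmult) auto
    have "inj_on (\<lambda>m. - of_nat m :: 'a) {..n}"
      by (auto intro: inj_onI)
    then show "card ((\<lambda>m. - of_nat m :: 'a) ` {..n}) > n"
      by (simp add: card_image)
    fix x :: 'a
    assume "x \<in> (\<lambda>m. - of_nat m) ` {..n}"
    then obtain m where m: "m \<le> n" "x = - of_nat m" by auto
    have "?g x = ((-1) ^ m * of_nat (n choose m) * f (of_nat m)) *
        (\<Prod>j\<in>{..n} - {m}. x + of_nat j)"
    proof (rule sum.remove[THEN trans, of "{..n}" m])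
      show "(-1) ^ m * of_nat (n choose m) * f (of_nat m) * (\<Prod>j\<in>{..n} - {m}. x + of_nat j)
        + (\<Sum>k\<in>{..n} - {m}. (-1) ^ k * of_nat (n choose k) * f (of_nat k) *
           (\<Prod>j\<in>{..n} - {k}. x + of_nat j))
        = (-1) ^ m * of_nat (n choose m) * f (of_nat m) * (\<Prod>j\<in>{..n} - {m}. x + of_nat j)"
        using m by (auto intro!: sum.neutral prod_zero bexI[of _ m])
    qed (use m in auto)
    also have "(\<Prod>j\<in>{..n} - {m}. x + of_nat j) = (-1) ^ m * fact m * fact (n - m)"
      using prod_of_nat_diff_except[OF m(1), where 'a = 'a] m(2) by (simp add: add.commute)
    finally have "?g x = (of_nat (n choose m) * fact m * fact (n - m)) * f (of_nat m)"
      by (simp add: mult_ac flip: power_add mult_2)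
    also have "of_nat (n choose m) * fact m * fact (n - m) = (fact n :: 'a)"
      using m(1) binomial_fact[of m n, where 'a = 'a] by (simp add: field_simps)
    finally show "fact n * f (- x) = ?g x" using m(2) by simp
  qed
  then show ?thesis by (rule fun_cong)
qed

text \<open>Dividing the interpolation formula by the product of all \<open>y + of_nat j\<close>
  yields a partial fraction expansion. This form evaluates the norms.\<close>

lemma alternating_binomial_sum_over_linear:
  fixes f :: "'a :: field_char_0 \<Rightarrow> 'a"
  assumes "polyfun n f" "pochhammer y (n + 1) \<noteq> 0"
  shows "(\<Sum>k\<le>n. (-1) ^ k * of_nat (n choose k) * (f (of_nat k) / (y + of_nat k))) =
    fact n * f (- y) / pochhammer y (n + 1)"
proof -
  have nz: "y + of_nat k \<noteq> 0" if "k \<le> n" for k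
    using assms(2) that by (auto simp: pochhammer_eq_0_iff eq_neg_iff_add_eq_0)
  have P: "pochhammer y (n + 1) = (\<Prod>j\<in>{..n}. y + of_nat j)"
    by (simp add: pochhammer_Suc_prod atLeast0AtMost)
  have "(\<Prod>j\<in>{..n} - {k}. y + of_nat j) = pochhammer y (n + 1) / (y + of_nat k)" if "k \<le> n" for k
    unfolding P using that nz[OF that] by (subst prod.remove[of "{..n}" k]) auto
  then have "fact n * f (- y) = (\<Sum>k\<le>n. (-1) ^ k * of_nat (n choose k) * f (of_nat k) *
      (pochhammer y (n + 1) / (y + of_nat k)))"
    unfolding lagrange_interpolation_nat[OF assms(1)] by (intro sum.cong) auto
  also have "\<dots> = pochhammer y (n + 1) *
      (\<Sum>k\<le>n. (-1) ^ k * of_nat (n choose k) * (f (of_nat k) / (y + of_nat k)))"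
    by (simp add: sum_distrib_left mult_ac)
  finally show ?thesis using assms(2) by (simp add: field_simps)
qed

lemma alternating_binomial_sum_eq_0:
  fixes f :: "'a :: field_char_0 \<Rightarrow> 'a"
  assumes "polyfun d f" "d < n"
  shows "(\<Sum>k\<le>n. (-1) ^ k * of_nat (n choose k) * f (of_nat k)) = 0"
proof -
  have nz: "1 + of_nat k \<noteq> (0 :: 'a)" for k
    by (metis of_nat_Suc of_nat_eq_0_iff nat.simps(3))
  \<comment> \<open>The factor \<open>x + 1\<close> cancels the denominator
    \<open>1 + of_nat k\<close> of the partial fraction formula at \<open>y = 1\<close>, and its
    zero at \<open>-1\<close> makes the right side of that formula vanish.\<close>
  have "polyfun n (\<lambda>x. f x * (1 * x + 1))"
    using polyfun_mult[OF assms(1) polyfun_linear[of 1 1]] by (rule polyfun_mono) (use assms(2) in simp)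
  from alternating_binomial_sum_over_linear[OF this, of 1] nz show ?thesis
    by (simp add: add.commute flip: pochhammer_fact)
qed

subsection \<open>Hankel determinants and orthogonality relations\<close>

text \<open>Cramer's rule for \<open>M a = s e_i0\<close>: apply the adjugate to both sides and read
  off the last component. The product form involves no division, so singular \<open>M\<close> is
  covered.\<close>

lemma det_via_kernel_vector:
  fixes M :: "'a :: comm_ring_1 mat"
  assumes M: "M \<in> carrier_mat (N + 1) (N + 1)" and i0: "i0 \<le> N"
    and a: "\<And>i. i \<le> N \<Longrightarrow> (\<Sum>k\<le>N. M $$ (i, k) * a k) = (if i = i0 then s else 0)"
  shows "a N * det M = (-1) ^ (i0 + N) * s * det (mat_delete M i0 N)"
proof -
  define v where "v = vec (N + 1) a"
  have v: "v \<in> carrier_vec (N + 1)" by (simp add: v_def)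
  have adj: "adj_mat M \<in> carrier_mat (N + 1) (N + 1)" "adj_mat M * M = det M \<cdot>\<^sub>m 1\<^sub>m (N + 1)"
    using adj_mat[OF M] by auto
  have Mv: "M *\<^sub>v v = s \<cdot>\<^sub>v unit_vec (N + 1) i0"
  proof (rule eq_vecI)
    fix i assume "i < dim_vec (s \<cdot>\<^sub>v unit_vec (N + 1) i0)"
    then have i: "i \<le> N" by simp
    have "(M *\<^sub>v v) $ i = (\<Sum>k\<le>N. M $$ (i, k) * a k)"
      using M i by (simp add: v_def scalar_prod_def Matrix.row_def atLeast0LessThan lessThan_Suc_atMost)
    then show "(M *\<^sub>v v) $ i = (s \<cdot>\<^sub>v unit_vec (N + 1) i0) $ i"
      using a[OF i] i i0 by (simp add: unit_vec_def)
  qed (use M in auto)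
  have "(det M \<cdot>\<^sub>m 1\<^sub>m (N + 1)) *\<^sub>v v = adj_mat M *\<^sub>v (M *\<^sub>v v)"
    using adj M v by (metis assoc_mult_mat_vec)
  then have "((det M \<cdot>\<^sub>m 1\<^sub>m (N + 1)) *\<^sub>v v) $ N = (adj_mat M *\<^sub>v (s \<cdot>\<^sub>v unit_vec (N + 1) i0)) $ N"
    by (simp add: Mv)
  moreover have "((det M \<cdot>\<^sub>m 1\<^sub>m (N + 1)) *\<^sub>v v) $ N = det M * a N"
  proof -
    have "((det M \<cdot>\<^sub>m 1\<^sub>m (N + 1)) *\<^sub>v v) $ N =
        (\<Sum>k\<in>{0..<N+1}. det M * (if k = N then 1 else 0) * a k)"
      unfolding v_def by (simp add: scalar_prod_def eq_commute del: sum.op_ivl_Suc)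
    also have "\<dots> = (\<Sum>k\<in>{0..<N+1}. (if k = N then det M * a N else 0))"
      by (intro sum.cong) auto
    finally show ?thesis by simp
  qed
  moreover have "(adj_mat M *\<^sub>v (s \<cdot>\<^sub>v unit_vec (N + 1) i0)) $ N = cofactor M i0 N * s"
  proof -
    have "(adj_mat M *\<^sub>v (s \<cdot>\<^sub>v unit_vec (N + 1) i0)) $ N =
        (\<Sum>k\<in>{0..<N+1}. cofactor M k N * (s * (if k = i0 then 1 else 0)))"
      using adj M i0 by (simp add: scalar_prod_def adj_mat_def unit_vec_def del: sum.op_ivl_Suc)
    also have "\<dots> = (\<Sum>k\<in>{0..<N+1}. if k = i0 then cofactor M i0 N * s else 0)"
      by (intro sum.cong) auto
    finally show ?thesis using i0 by simp
  qed
  ultimately show ?thesis by (simp add: cofactor_def mult_ac)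
qed

text \<open>Indexed by the size, so that the empty determinant can start the inductions.\<close>
definition hdet :: "nat \<Rightarrow> (nat \<Rightarrow> 'a :: comm_ring_1) \<Rightarrow> 'a" where
  "hdet N c = det (mat N N (\<lambda>(i, j). c (i + j)))"

lemma hdet_0 [simp]: "hdet 0 c = 1"
  by (simp add: hdet_def)

lemma hankel_det_eq_hdet: "hankel_det n c = hdet (n + 1) c"
  by (simp add: hankel_det_def hdet_def)

text \<open>With \<open>a\<close> the coefficients of the \<open>N\<close>-th orthogonal polynomial,
  the Hankel matrix sends \<open>a\<close> to a multiple of the last unit vector, and the
  complementary minor is the Hankel determinant one size smaller.\<close>

lemma hdet_Suc_orthogonal:
  fixes c :: "nat \<Rightarrow> 'a :: comm_ring_1"
  assumes "\<And>j. j < N \<Longrightarrow> (\<Sum>k\<le>N. a k * c (k + j)) = 0"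
  shows "a N * hdet (N + 1) c = (\<Sum>k\<le>N. a k * c (k + N)) * hdet N c"
proof -
  let ?M = "mat (N + 1) (N + 1) (\<lambda>(i, j). c (i + j))"
  have "a N * det ?M = (-1) ^ (N + N) * (\<Sum>k\<le>N. a k * c (k + N)) * det (mat_delete ?M N N)"
    by (rule det_via_kernel_vector) (use assms in \<open>auto simp: mult.commute add.commute\<close>)
  moreover have "mat_delete ?M N N = mat N N (\<lambda>(i, j). c (i + j))"
    by (rule eq_matI) (auto simp: mat_delete_def)
  ultimately show ?thesis by (simp add: hdet_def flip: mult_2)
qed

text \<open>Orthogonality now refers to the moments \<open>c (k + 1)\<close>, so the Hankel matrix
  of \<open>c\<close> sends \<open>a\<close> to a multiple of the first unit vector; deleting row 0
  and the last column leaves the shifted Hankel matrix.\<close>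

lemma hdet_Suc_orthogonal_shift:
  fixes c :: "nat \<Rightarrow> 'a :: comm_ring_1"
  assumes "\<And>j. j < N \<Longrightarrow> (\<Sum>k\<le>N. a k * c (k + j + 1)) = 0"
  shows "a N * hdet (N + 1) c = (-1) ^ N * (\<Sum>k\<le>N. a k * c k) * hdet N (\<lambda>k. c (k + 1))"
proof -
  let ?M = "mat (N + 1) (N + 1) (\<lambda>(i, j). c (i + j))"
  have "a N * det ?M = (-1) ^ (0 + N) * (\<Sum>k\<le>N. a k * c k) * det (mat_delete ?M 0 N)"
  proof (rule det_via_kernel_vector)
    fix i assume i: "i \<le> N"
    show "(\<Sum>k\<le>N. ?M $$ (i, k) * a k) = (if i = 0 then \<Sum>k\<le>N. a k * c k else 0)"
    proof (cases i)
      case (Suc j)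
      then have "(\<Sum>k\<le>N. ?M $$ (i, k) * a k) = (\<Sum>k\<le>N. a k * c (k + j + 1))"
        using i by (intro sum.cong) (auto simp: mult.commute add.commute)
      then show ?thesis using assms[of j] i Suc by simp
    qed (auto simp: mult.commute intro!: sum.cong)
  qed auto
  moreover have "mat_delete ?M 0 N = mat N N (\<lambda>(i, j). c (i + j + 1))"
    by (rule eq_matI) (auto simp: mat_delete_def)
  ultimately show ?thesis by (simp add: hdet_def)
qed

lemma hdet_shift_orthogonal:
  fixes c :: "nat \<Rightarrow> 'a :: comm_ring_1"
  assumes "\<And>j. j < N \<Longrightarrow> (\<Sum>k\<le>N. a k * c (k + j)) = 0"
  shows "a N * hdet N (\<lambda>k. c (k + 1)) = (-1) ^ N * a 0 * hdet N c"
proof -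
  \<comment> \<open>Bordering with the row \<open>(1, 0, \<dots>, 0)\<close> makes both determinants minors of one matrix.\<close>
  let ?M = "mat (N + 1) (N + 1) (\<lambda>(i, j). if i = N then (if j = 0 then 1 else 0) else c (i + j))"
  have "a N * det ?M = (-1) ^ (N + N) * a 0 * det (mat_delete ?M N N)"
  proof (rule det_via_kernel_vector)
    fix i assume i: "i \<le> N"
    show "(\<Sum>k\<le>N. ?M $$ (i, k) * a k) = (if i = N then a 0 else 0)"
    proof (cases "i = N")
      case True
      then have "(\<Sum>k\<le>N. ?M $$ (i, k) * a k) = (\<Sum>k\<le>N. if k = 0 then a 0 else 0)"
        by (intro sum.cong) auto
      then show ?thesis using True by simp
    next
      case False
      then have "(\<Sum>k\<le>N. ?M $$ (i, k) * a k) = (\<Sum>k\<le>N. a k * c (k + i))"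
        using i by (intro sum.cong) (auto simp: mult.commute add.commute)
      then show ?thesis using False i assms[of i] by simp
    qed
  qed auto
  moreover have "mat_delete ?M N N = mat N N (\<lambda>(i, j). c (i + j))"
    by (rule eq_matI) (auto simp: mat_delete_def)
  moreover have "det ?M = (-1) ^ N * hdet N (\<lambda>k. c (k + 1))"
  proof -
    have "mat_delete ?M N 0 = mat N N (\<lambda>(i, j). c (i + j + 1))"
      by (rule eq_matI) (auto simp: mat_delete_def)
    then have *: "cofactor ?M N 0 = (-1) ^ N * hdet N (\<lambda>k. c (k + 1))"
      by (simp add: cofactor_def hdet_def)
    have "det ?M = (\<Sum>j<N + 1. ?M $$ (N, j) * cofactor ?M N j)"
      by (rule laplace_expansion_row) auto
    also have "\<dots> = (\<Sum>j<N + 1. if j = 0 then cofactor ?M N 0 else 0)"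
      by (intro sum.cong) auto
    also have "\<dots> = cofactor ?M N 0"
      by (subst sum.delta) auto
    also note *
    finally show ?thesis .
  qed
  ultimately have "a N * ((-1) ^ N * hdet N (\<lambda>k. c (k + 1))) = a 0 * hdet N c"
    by (simp add: hdet_def flip: mult_2)
  then have "(-1) ^ N * (a N * ((-1) ^ N * hdet N (\<lambda>k. c (k + 1)))) = (-1) ^ N * (a 0 * hdet N c)"
    by simp
  then show ?thesis by (simp add: mult_ac left_minus_one_mult_self)
qed

subsection \<open>Bernoulli polynomials\<close>

lemma fps_exp_1_minus_1_neq_0: "fps_exp 1 - 1 \<noteq> (0 :: 'a :: field_char_0 fps)"
proof
  assume "fps_exp 1 - 1 = (0 :: 'a fps)"
  then have "fps_nth (fps_exp 1 - 1) 1 = (0 :: 'a)" by simp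
  then show False by simp
qed

lemma bernpoly_Suc_diff:
  fixes x :: "'a :: field_char_0"
  shows "bernpoly (Suc n) (x + 1) - bernpoly (Suc n) x = of_nat (Suc n) * x ^ n"
proof -
  let ?G = "\<lambda>x :: 'a. Abs_fps (\<lambda>n. bernpoly n x / fact n)"
  have "(?G (x + 1) - ?G x) * (fps_exp 1 - 1) = fps_X * fps_exp x * (fps_exp 1 - 1)"
    by (simp only: left_diff_distrib bernpoly_generating_function fps_exp_add_mult)
      (simp add: algebra_simps)
  then have "?G (x + 1) - ?G x = fps_X * fps_exp x"
    using fps_exp_1_minus_1_neq_0 by (metis mult_right_cancel)
  then have "fps_nth (?G (x + 1) - ?G x) (Suc n) = fps_nth (fps_X * fps_exp x) (Suc n)"
    by simp
  then have "(bernpoly (Suc n) (x + 1) - bernpoly (Suc n) x) / fact (Suc n) = x ^ n / fact n"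
    by (simp add: diff_divide_distrib)
  then have "fact n * (bernpoly (Suc n) (x + 1) - bernpoly (Suc n) x) = fact n * (of_nat (Suc n) * x ^ n)"
    by (simp add: field_simps del: of_nat_Suc)
  then show ?thesis by (simp del: of_nat_Suc)
qed

text \<open>Compare coefficients of \<open>t^(n+1)\<close> in the generating function identity. As a
  finite expression in powers of \<open>x\<close> and constants, the recursion gives both the degree
  bound and the evaluation of \<open>bernpoly\<close> at rational functions.\<close>

lemma bernpoly_rec:
  fixes x :: "'a :: field_char_0"
  shows "bernpoly n x = x ^ n - fact n * (\<Sum>k<n. bernpoly k x / (fact k * fact (Suc n - k)))"
proof -
  have "x ^ n / fact n = fps_nth (fps_X * fps_exp x) (Suc n)" by simp
  also have "\<dots> = (\<Sum>k = 0..Suc n. bernpoly k x / fact k * fps_nth (fps_exp 1 - 1) (Suc n - k))"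
    by (simp add: fps_mult_nth flip: bernpoly_generating_function)
  also have "\<dots> = (\<Sum>k = 0..n. bernpoly k x / fact k * fps_nth (fps_exp 1 - 1) (Suc n - k))"
    by (simp add: mult.commute)
  also have "\<dots> = (\<Sum>k = 0..n. bernpoly k x / (fact k * fact (Suc n - k)))"
    by (intro sum.cong) (auto simp: Suc_diff_le simp del: fact_Suc)
  also have "\<dots> = (\<Sum>k<n. bernpoly k x / (fact k * fact (Suc n - k))) + bernpoly n x / fact n"
    by (simp add: atLeast0AtMost flip: lessThan_Suc_atMost)
  finally show ?thesis by (simp add: field_simps)
qed

text \<open>Replacing \<open>t\<close> by \<open>-t\<close> in the generating function identity at
  \<open>x = 0\<close> and multiplying by \<open>e^t\<close> gives the identity that characterises
  the generating function at \<open>x = 1\<close>.\<close>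

lemma bernpoly_1_eq: "bernpoly n (1 :: 'a :: field_char_0) = (-1) ^ n * bernpoly n 0"
proof -
  let ?G = "\<lambda>x :: 'a. Abs_fps (\<lambda>n. bernpoly n x / fact n)"
  have neg: "(f oo - fps_X) = Abs_fps (\<lambda>n. (-1) ^ n * fps_nth f n)" for f :: "'a fps"
    using fps_compose_linear[of f "-1"] by (simp add: fps_const_neg[symmetric] del: fps_const_neg)
  have "(?G 0 * (fps_exp 1 - 1)) oo - fps_X = fps_X oo (- fps_X)"
    by (simp add: bernpoly_generating_function)
  then have "(?G 0 oo - fps_X) * ((fps_exp 1 - 1) oo - fps_X) = - fps_X"
    by (simp add: fps_compose_mult_distrib)
  moreover have "((fps_exp 1 - 1) oo - fps_X) = fps_exp (-1) - (1 :: 'a fps)"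
    unfolding neg by (rule fps_ext) auto
  ultimately have "(?G 0 oo - fps_X) * (fps_exp (-1) - 1) * fps_exp 1 = - fps_X * fps_exp 1"
    by simp
  moreover have "(fps_exp (-1) - 1) * fps_exp 1 = 1 - fps_exp (1 :: 'a)"
    by (simp add: algebra_simps flip: fps_exp_add_mult)
  ultimately have "(?G 0 oo - fps_X) * (1 - fps_exp 1) = - fps_X * fps_exp 1"
    by (simp only: mult.assoc)
  then have "(?G 0 oo - fps_X) * (fps_exp 1 - 1) = ?G 1 * (fps_exp 1 - 1)"
    unfolding bernpoly_generating_function by (simp add: algebra_simps)
  then have "(?G 0 oo - fps_X) = ?G 1"
    using fps_exp_1_minus_1_neq_0 by (metis mult_right_cancel)
  then have "fps_nth (?G 0 oo - fps_X) n = fps_nth (?G 1) n" by simp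
  then show ?thesis unfolding neg by (simp add: field_simps)
qed

lemma bernpoly_odd_1: "odd n \<Longrightarrow> n > 1 \<Longrightarrow> bernpoly n (1 :: 'a :: field_char_0) = 0"
proof -
  assume n: "odd n" "n > 1"
  then obtain m where m: "n = Suc m" "m > 0" by (cases n) auto
  have "bernpoly n 1 = bernpoly n (0 :: 'a)"
    using bernpoly_Suc_diff[of m "0 :: 'a"] m by (simp add: power_0_left)
  moreover have "bernpoly n 1 = - bernpoly n (0 :: 'a)"
    using bernpoly_1_eq[of n] n(1) by simp
  ultimately show ?thesis by simp
qed

text \<open>Telescoping of \<open>bernpoly_Suc_diff\<close>; no constant remains because the odd
  index \<open>2 * k + 5\<close> makes the value at 1 vanish.\<close>

lemma bernpoly_eq_power_sum:
  "bernpoly (2 * k + 5) (of_nat r + 1) / of_nat (2 * k + 5) = power_sum r (2 * k + 4)"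
proof (induction r)
  case 0
  then show ?case by (simp add: bernpoly_odd_1 power_sum_def)
next
  case (Suc r)
  have "bernpoly (2 * k + 5) (of_nat (Suc r) + 1) - bernpoly (2 * k + 5) (of_nat (Suc r)) =
      of_nat (2 * k + 5) * (of_nat (Suc r) :: rat) ^ (2 * k + 4)"
    using bernpoly_Suc_diff[of "2 * k + 4" "of_nat (Suc r) :: rat"]
    by (simp del: of_nat_Suc add: eval_nat_numeral)
  then have "bernpoly (2 * k + 5) (of_nat (Suc r) + 1) / of_nat (2 * k + 5) =
      bernpoly (2 * k + 5) (of_nat r + 1) / of_nat (2 * k + 5) + (of_nat (Suc r) :: rat) ^ (2 * k + 4)"
    by (simp add: field_simps del: of_nat_add of_nat_mult power_Suc)
  then show ?case unfolding Suc.IH by (simp add: power_sum_def)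
qed

lemma polyfun_bernpoly: "polyfun n (bernpoly n)"
proof (induction n rule: less_induct)
  case (less n)
  have "polyfun n (\<lambda>x. x ^ n + (- fact n) * (\<Sum>k<n. (1 / (fact k * fact (Suc n - k))) * bernpoly k x) :: 'a)"
  proof (intro polyfun_add polyfun_cmult polyfun_sum)
    show "polyfun n (\<lambda>x :: 'a. x ^ n)"
    proof -
      have "poly (Polynomial.monom 1 n) = (\<lambda>x :: 'a. x ^ n)"
        by (rule ext) (simp add: poly_monom)
      then show ?thesis
        using polyfun_poly[of "Polynomial.monom (1 :: 'a) n" n] by (simp add: degree_monom_eq)
    qed
    show "polyfun n (bernpoly k :: 'a \<Rightarrow> 'a)" if "k \<in> {..<n}" for k
      using less.IH[of k] that by (auto elim: polyfun_mono)
  qed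
  moreover have "(\<lambda>x. x ^ n + (- fact n) * (\<Sum>k<n. (1 / (fact k * fact (Suc n - k))) * bernpoly k x)) =
      (bernpoly n :: 'a \<Rightarrow> 'a)"
    by (subst bernpoly_rec[abs_def]) simp
  ultimately show ?case by simp
qed

text \<open>Faulhaber's formula, monomial by monomial. The argument \<open>x + 1\<close> makes the
  difference a backward one, so that \<open>F r\<close> equals the sum of \<open>f\<close> over
  \<open>1..r\<close>; subtracting the values at 1 normalises \<open>F 0\<close>.\<close>

lemma polyfun_antidifference:
  assumes "polyfun d f"
  obtains F where "polyfun (d + 1) F" "F 0 = 0" "\<And>x. F x - F (x - 1) = f x"
proof -
  obtain p where p: "degree p \<le> d" "\<And>x. f x = poly p x"
    using assms unfolding polyfun_def by auto
  define F where "F = (\<lambda>x. \<Sum>k\<le>degree p. poly.coeff p k / of_nat (Suc k) *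
    (bernpoly (Suc k) (x + 1) + (- bernpoly (Suc k) 1)))"
  have "polyfun (d + 1) (\<lambda>x :: 'a. bernpoly (Suc k) (x + 1))" if "k \<le> degree p" for k
    using polyfun_compose_linear[OF polyfun_bernpoly[of "Suc k"], of 1 1] that p(1)
    by (auto elim!: polyfun_mono)
  then have "polyfun (d + 1) F"
    unfolding F_def by (intro polyfun_sum polyfun_cmult polyfun_add polyfun_const) auto
  moreover have "F 0 = 0" by (simp add: F_def)
  moreover have "F x - F (x - 1) = f x" for x
  proof -
    have "F x - F (x - 1) = (\<Sum>k\<le>degree p. poly.coeff p k / of_nat (Suc k) *
        (bernpoly (Suc k) (x + 1) - bernpoly (Suc k) x))"
      unfolding F_def sum_subtractf[symmetric] by (intro sum.cong) (simp_all add: algebra_simps)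
    also have "\<dots> = f x"
      unfolding bernpoly_Suc_diff p(2) poly_altdef by (intro sum.cong) (simp_all del: of_nat_Suc)
    finally show ?thesis .
  qed
  ultimately show ?thesis using that by blast
qed

subsection \<open>The orthogonal polynomials\<close>

text \<open>At \<open>c^2\<close> this is \<open>(1-c)_k (1+c)_k\<close>, a numerator pair of the
  hypergeometric series, with the roots \<open>c = 1..k\<close>.\<close>

definition node_poly :: "nat \<Rightarrow> 'a :: field_char_0 poly" where
  "node_poly k = (\<Prod>i = 1..k. [:of_nat i ^ 2, -1:])"

text \<open>The series coefficient times \<open>(3/2)_n (1-r)_n (2+r)_n\<close>: for instance
  \<open>(1-r)_n / (1-r)_k\<close> becomes \<open>(k+1-r)_(n-k)\<close>, and
  \<open>(3/2)_n (n+3/2)_k / (3/2)_k\<close> becomes \<open>(k+3/2)_n\<close>.\<close>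

definition ortho_coeff :: "nat \<Rightarrow> 'a :: field_char_0 \<Rightarrow> nat \<Rightarrow> 'a" where
  "ortho_coeff n r k = (-1) ^ k * of_nat (n choose k) * pochhammer (of_nat k + 3 / 2) n
     * pochhammer (of_nat k + 1 - r) (n - k) * pochhammer (of_nat k + 2 + r) (n - k)"

text \<open>
  In the variable \<open>t = c\<^sup>2\<close> and up to a constant, this is the Racah polynomial
  \<open>\<^sub>4F\<^sub>3(-n, n + 3/2, 1 - c, 1 + c; 3/2, 1 - r, 2 + r; 1)\<close>, cleared of the denominators that depend
  on \<open>r\<close>.
\<close>
definition ortho_poly :: "nat \<Rightarrow> 'a :: field_char_0 \<Rightarrow> 'a poly" where
  "ortho_poly n r = (\<Sum>k\<le>n. Polynomial.smult (ortho_coeff n r k) (node_poly k))"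

lemma poly_node_poly: "poly (node_poly k) (c\<^sup>2) = (\<Prod>i = 1..k. of_nat i ^ 2 - c\<^sup>2)"
  by (simp add: node_poly_def poly_prod)

lemma poly_node_poly_Suc: "poly (node_poly (Suc k)) t = poly (node_poly k) t * (of_nat (Suc k) ^ 2 - t)"
  by (simp add: node_poly_def algebra_simps)

lemma poly_prod_linear_degree:
  fixes a :: "nat \<Rightarrow> 'a :: field_char_0"
  assumes "finite A"
  shows "degree (\<Prod>i\<in>A. [:a i, -1:]) = card A \<and> lead_coeff (\<Prod>i\<in>A. [:a i, -1:]) = (-1) ^ card A"
proof
  show "lead_coeff (\<Prod>i\<in>A. [:a i, -1:]) = (-1) ^ card A"
    using assms by (simp add: lead_coeff_prod)
  show "degree (\<Prod>i\<in>A. [:a i, -1:]) = card A"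
    using assms by (subst degree_prod_eq_sum_degree) auto
qed

lemma degree_node_poly: "degree (node_poly k) = k"
  and lead_coeff_node_poly: "lead_coeff (node_poly k) = (-1) ^ k"
  using poly_prod_linear_degree[of "{1..k}" "\<lambda>i. of_nat i ^ 2"] by (auto simp: node_poly_def)

lemma degree_ortho_poly: "degree (ortho_poly n r) \<le> n"
  unfolding ortho_poly_def
  by (rule degree_sum_le) (auto intro!: order_trans[OF degree_smult_le] simp: degree_node_poly)

lemma coeff_ortho_poly: "poly.coeff (ortho_poly n (r :: 'a :: field_char_0)) n = pochhammer (of_nat n + 3 / 2) n"
proof -
  have lead: "lead_coeff (node_poly n :: 'a poly) = (-1) ^ n"
    by (rule lead_coeff_node_poly)
  have "poly.coeff (ortho_poly n r) n =
      (\<Sum>k\<le>n. ortho_coeff n r k * poly.coeff (node_poly k) n)"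
    by (simp add: ortho_poly_def coeff_sum)
  also have "\<dots> = (\<Sum>k\<le>n. if k = n then ortho_coeff n r n * (-1) ^ n else 0)"
    using lead
    by (intro sum.cong) (auto simp: degree_node_poly coeff_eq_0)
  also have "\<dots> = pochhammer (of_nat n + 3 / 2) n"
    by (simp add: ortho_coeff_def)
  finally show ?thesis .
qed

lemma poly_ortho_poly:
  "poly (ortho_poly n r) t = (\<Sum>k\<le>n. ortho_coeff n r k * poly (node_poly k) t)"
  by (simp add: ortho_poly_def poly_sum)

section \<open>Weighted sums of products of the two bases\<close>

lemma pochhammer_extend:
  "pochhammer (a - 1) (n + 2) = (a - 1) * pochhammer a n * (a + of_nat n)"
  for a :: "'a :: comm_ring_1"
  using pochhammer_rec[of "a - 1" "n + 1"] pochhammer_Suc[of a n] by (simp add: mult_ac)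

lemma times_poly_node_poly:
  fixes c :: "'a :: field_char_0"
  shows "c * poly (node_poly k) (c\<^sup>2) = (-1) ^ k * pochhammer (c - of_nat k) (2 * k + 1)"
proof (induction k)
  case 0
  then show ?case by (simp add: node_poly_def)
next
  case (Suc k)
  define Q where "Q = pochhammer (c - of_nat k) (2 * k + 1)"
  have A: "pochhammer (c - of_nat (Suc k)) (2 * Suc k + 1) = (c - of_nat k - 1) * Q * (c + of_nat k + 1)"
    using pochhammer_extend[of "c - of_nat k" "2 * k + 1"] by (simp add: Q_def algebra_simps)
  have "c * poly (node_poly (Suc k)) (c\<^sup>2) = (-1) ^ k * Q * (of_nat (Suc k) ^ 2 - c\<^sup>2)"
    using Suc.IH by (simp add: poly_node_poly_Suc Q_def)
  also have "\<dots> = (-1) ^ Suc k * ((c - of_nat k - 1) * Q * (c + of_nat k + 1))"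
    by (simp add: algebra_simps power2_eq_square)
  finally show ?case by (simp only: A)
qed

text \<open>Its roots are the \<open>j\<close> largest nodes \<open>c = r, r-1, ..., r-j+1\<close>.
  Against \<open>node_poly\<close> these polynomials have closed sums, which plain powers of
  \<open>t\<close> do not offer.\<close>

definition test_poly :: "nat \<Rightarrow> 'a :: field_char_0 \<Rightarrow> 'a poly" where
  "test_poly j r = (\<Prod>i<j. [:(r - of_nat i) ^ 2, -1:])"

lemma degree_test_poly: "degree (test_poly j r) = j"
  and lead_coeff_test_poly: "lead_coeff (test_poly j r) = (-1) ^ j"
  using poly_prod_linear_degree[of "{..<j}" "\<lambda>i. (r - of_nat i) ^ 2"] by (auto simp: test_poly_def)

lemma poly_test_poly_Suc:
  "poly (test_poly (Suc j) r) t = poly (test_poly j r) t * ((r - of_nat j) ^ 2 - t)"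
  by (simp add: test_poly_def algebra_simps)

lemma sum_node_poly:
  "(\<Sum>c = 1..r. of_nat c ^ 2 * poly (node_poly k) (of_nat c ^ 2) :: rat) =
    (-1) ^ k / 2 * pochhammer (of_nat r - of_nat k) (2 * k + 2) * (of_nat r + 1 / 2) / (of_nat k + 3 / 2)"
proof (induction r)
  case 0
  have "pochhammer (- of_nat k :: rat) (2 * k + 2) = 0"
    by (rule pochhammer_of_nat_eq_0_lemma) simp
  then show ?case by simp
next
  case (Suc r)
  define x where "x = (of_nat (Suc r) :: rat)"
  define y where "y = (of_nat k :: rat)"
  define Q where "Q = pochhammer (x - y) (2 * k + 1)"
  have y: "2 * y + 3 \<noteq> 0" by (simp add: y_def add_pos_nonneg less_imp_neq[symmetric])
  have A: "pochhammer (x - y) (2 * k + 2) = Q * (x + y + 1)"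
    unfolding Q_def by (simp add: pochhammer_Suc y_def algebra_simps)
  have B: "pochhammer (x - 1 - y) (2 * k + 2) = (x - 1 - y) * Q"
    using pochhammer_rec[of "x - 1 - y" "2 * k + 1"] unfolding Q_def
    by (simp add: algebra_simps)
  have "x ^ 2 * poly (node_poly k) (x ^ 2) = (-1) ^ k * x * Q"
    using times_poly_node_poly[of x k] by (simp add: power2_eq_square Q_def y_def)
  then have "(\<Sum>c = 1..Suc r. of_nat c ^ 2 * poly (node_poly k) (of_nat c ^ 2) :: rat) =
      (-1) ^ k / 2 * ((x - 1 - y) * Q) * (x - 1 / 2) / (y + 3 / 2) + (-1) ^ k * x * Q"
    using Suc B by (simp add: x_def y_def)
  also have "\<dots> = (-1) ^ k / 2 * (Q * (x + y + 1)) * (x + 1 / 2) / (y + 3 / 2)"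
    using y by (simp add: field_simps)
  finally show ?case unfolding A[symmetric] by (simp only: x_def y_def)
qed

text \<open>Writing \<open>(r-j)^2 - t\<close> as \<open>((r-j)^2 - (k+1)^2) + ((k+1)^2 - t)\<close>
  turns the new test factor into a multiple of the sum for \<open>k\<close>, \<open>j\<close> plus
  the sum for \<open>k+1\<close>, \<open>j\<close>. Hence an induction on \<open>j\<close> with
  \<open>k\<close> arbitrary.\<close>

lemma sum_node_poly_test_poly:
  "(\<Sum>c = 1..r. of_nat c ^ 2 * poly (node_poly k) (of_nat c ^ 2) * poly (test_poly j (of_nat r)) (of_nat c ^ 2) :: rat) =
    (-1) ^ k / 2 * fact j * pochhammer (of_nat r - of_nat k - of_nat j) (2 * k + j + 2)
      * pochhammer (of_nat r + 1 / 2 - of_nat j) (j + 1) / pochhammer (of_nat k + 3 / 2) (j + 1)"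
proof (induction j arbitrary: k)
  case 0
  then show ?case using sum_node_poly[of k r] by (simp add: test_poly_def)
next
  case (Suc j)
  define S where "S = (\<lambda>k j. \<Sum>c = 1..r. of_nat c ^ 2 * poly (node_poly k) (of_nat c ^ 2) *
    poly (test_poly j (of_nat r)) (of_nat c ^ 2) :: rat)"
  define x where "x = (of_nat r :: rat)"
  define y where "y = (of_nat k :: rat)"
  define z where "z = (of_nat j :: rat)"
  define Q where "Q = pochhammer (x - y - z) (2 * k + j + 2)"
  define R where "R = pochhammer (x + 1 / 2 - z) (j + 1)"
  define T where "T = pochhammer (y + 3 / 2) (j + 1)"
  have aux: "p * a * (C * Q * R / T) + - (C * (p * Q * b) * R / (T * w / v)) = C * Q * R / T * (p * (a - b * v / w))"
    for p a b v w C :: rat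
    by (simp add: algebra_simps)
  have nn: "y \<ge> 0" "z \<ge> 0" by (simp_all add: y_def z_def)
  have "S k (Suc j) = ((x - z)\<^sup>2 - (y + 1)\<^sup>2) * S k j + S (Suc k) j"
    unfolding S_def sum_distrib_left sum.distrib[symmetric]
    by (intro sum.cong refl)
      (simp add: poly_test_poly_Suc poly_node_poly_Suc x_def y_def z_def algebra_simps)
  also have "S k j = (-1) ^ k / 2 * fact j * Q * R / T"
    unfolding S_def Suc.IH by (simp add: Q_def R_def T_def x_def y_def z_def)
  also have "S (Suc k) j = - ((-1) ^ k / 2 * fact j * ((x - y - z - 1) * Q * (x + y + 2)) * R / (T * (y + z + 5 / 2) / (y + 3 / 2)))"
  proof -
    have "pochhammer (x - y - z - 1) (2 * k + j + 4) = (x - y - z - 1) * Q * (x + y + 2)"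
      using pochhammer_extend[of "x - y - z" "2 * k + j + 2"]
      by (simp add: Q_def x_def y_def z_def algebra_simps eval_nat_numeral)
    moreover have "(y + 3 / 2) * pochhammer (y + 5 / 2) (j + 1) = T * (y + z + 5 / 2)"
      using pochhammer_rec[of "y + 3 / 2" "j + 1"] pochhammer_Suc[of "y + 3 / 2" "j + 1"]
      by (simp add: T_def z_def algebra_simps)
    then have "pochhammer (y + 5 / 2) (j + 1) = T * (y + z + 5 / 2) / (y + 3 / 2)"
      using nn by (simp add: field_simps)
    moreover have "S (Suc k) j = (-1) ^ Suc k / 2 * fact j * pochhammer (x - y - z - 1) (2 * k + j + 4)
        * R / pochhammer (y + 5 / 2) (j + 1)"
    proof -
      have "of_nat r - of_nat (Suc k) - of_nat j = x - y - z - 1" "2 * Suc k + j + 2 = 2 * k + j + 4"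
        "of_nat (Suc k) + 3 / 2 = y + 5 / 2"
        by (simp_all add: x_def y_def z_def)
      then show ?thesis
        unfolding S_def Suc.IH by (simp only: R_def x_def z_def)
    qed
    ultimately show ?thesis
      by (simp only: power_Suc mult_minus_left minus_divide_left mult_1)
  qed
  also have "(x - z)\<^sup>2 - (y + 1)\<^sup>2 = (x - y - z - 1) * (x - z + y + 1)"
    by (simp add: algebra_simps power2_eq_square)
  also have "(x - y - z - 1) * (x - z + y + 1) * ((-1) ^ k / 2 * fact j * Q * R / T) +
      - ((-1) ^ k / 2 * fact j * ((x - y - z - 1) * Q * (x + y + 2)) * R / (T * (y + z + 5 / 2) / (y + 3 / 2)))
    = (-1) ^ k / 2 * fact j * Q * R / T * ((x - y - z - 1) *
        ((x - z + y + 1) - (x + y + 2) * (y + 3 / 2) / (y + z + 5 / 2)))"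
    by (rule aux)
  \<comment> \<open>The identity that closes the recursion: once the common factors are pulled out,
    the sum of the two terms factors again.\<close>
  also have "(x - z + y + 1) - (x + y + 2) * (y + 3 / 2) / (y + z + 5 / 2) =
      (z + 1) * (x - z - 1 / 2) / (y + z + 5 / 2)"
    using nn by (simp add: field_simps)
  also have "(-1) ^ k / 2 * fact j * Q * R / T * ((x - y - z - 1) *
      ((z + 1) * (x - z - 1 / 2) / (y + z + 5 / 2))) =
      (-1) ^ k / 2 * ((z + 1) * fact j) * ((x - y - z - 1) * Q) * ((x - z - 1 / 2) * R) / (T * (y + z + 5 / 2))"
    by (simp add: mult_ac)
  also have "(z + 1) * fact j = fact (Suc j)"
    by (simp add: z_def add.commute)
  also have "(x - y - z - 1) * Q = pochhammer (of_nat r - of_nat k - of_nat (Suc j)) (2 * k + Suc j + 2)"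
    using pochhammer_rec[of "x - y - z - 1" "2 * k + j + 2"]
    by (simp add: Q_def x_def y_def z_def algebra_simps)
  also have "(x - z - 1 / 2) * R = pochhammer (of_nat r + 1 / 2 - of_nat (Suc j)) (Suc j + 1)"
    using pochhammer_rec[of "x - z - 1 / 2" "j + 1"]
    by (simp add: R_def x_def z_def algebra_simps)
  also have "T * (y + z + 5 / 2) = pochhammer (of_nat k + 3 / 2) (Suc j + 1)"
    using pochhammer_Suc[of "y + 3 / 2" "j + 1"]
    by (simp add: T_def y_def z_def algebra_simps)
  finally show ?case unfolding S_def .
qed

text \<open>Up to sign, the factors run through the adjacent ranges \<open>r-n .. r-k-1\<close>,
  \<open>r-k .. r+k+1\<close> and \<open>r+k+2 .. r+n+1\<close>. Together they form
  \<open>(r-n)_(2n+2)\<close>, which is free of \<open>k\<close>; only the \<open>j\<close> lowest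
  factors of the third symbol are left over.\<close>

lemma pochhammer_glue:
  fixes r :: "'a :: comm_ring_1"
  assumes "k \<le> n"
  shows "pochhammer (of_nat k + 1 - r) (n - k) * pochhammer (of_nat k + 2 + r) (n - k)
      * pochhammer (r - of_nat k - of_nat j) (2 * k + j + 2) =
    (-1) ^ (n - k) * pochhammer (r - of_nat n) (2 * n + 2) * pochhammer (r - of_nat k - of_nat j) j"
proof -
  have 1: "pochhammer (of_nat k + 1 - r) (n - k) = (-1) ^ (n - k) * pochhammer (r - of_nat n) (n - k)"
    using pochhammer_minus[of "r - of_nat k - 1" "n - k"] assms
    by (simp add: of_nat_diff algebra_simps)
  have 2: "pochhammer (r - of_nat k - of_nat j) (2 * k + j + 2) =
      pochhammer (r - of_nat k - of_nat j) j * pochhammer (r - of_nat k) (2 * k + 2)"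
    using pochhammer_product'[of "r - of_nat k - of_nat j" j "2 * k + 2"]
    by (simp add: algebra_simps)
  have "pochhammer (r - of_nat n) ((n - k) + ((2 * k + 2) + (n - k))) =
      pochhammer (r - of_nat n) (n - k) * (pochhammer (r - of_nat k) (2 * k + 2) *
        pochhammer (of_nat k + 2 + r) (n - k))"
    unfolding pochhammer_product' using assms by (simp add: of_nat_diff algebra_simps)
  moreover have "(n - k) + ((2 * k + 2) + (n - k)) = 2 * n + 2"
    using assms by simp
  ultimately have 3: "pochhammer (r - of_nat n) (2 * n + 2) =
      pochhammer (r - of_nat n) (n - k) * (pochhammer (r - of_nat k) (2 * k + 2) *
        pochhammer (of_nat k + 2 + r) (n - k))" by (simp only:)
  show ?thesis unfolding 1 2 3 by (simp only: mult_ac)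
qed

lemma sum_ortho_poly_test_poly:
  "(\<Sum>c = 1..r. of_nat c ^ 2 * poly (ortho_poly n (of_nat r)) (of_nat c ^ 2)
      * poly (test_poly j (of_nat r)) (of_nat c ^ 2) :: rat) =
    (-1) ^ n / 2 * fact j * pochhammer (of_nat r - of_nat n) (2 * n + 2)
      * pochhammer (of_nat r + 1 / 2 - of_nat j) (j + 1)
      * (\<Sum>k\<le>n. (-1) ^ k * of_nat (n choose k) * (pochhammer (of_nat k + 3 / 2) n
          / pochhammer (of_nat k + 3 / 2) (j + 1) * pochhammer (of_nat r - of_nat k - of_nat j) j))"
  (is "?L = _")
proof -
  let ?r = "of_nat r :: rat"
  have "?L = (\<Sum>c = 1..r. \<Sum>k\<le>n. ortho_coeff n ?r k * (of_nat c ^ 2 * poly (node_poly k) (of_nat c ^ 2)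
      * poly (test_poly j ?r) (of_nat c ^ 2)))"
    by (simp add: poly_ortho_poly sum_distrib_left sum_distrib_right mult_ac)
  also have "\<dots> = (\<Sum>k\<le>n. ortho_coeff n ?r k * (\<Sum>c = 1..r. of_nat c ^ 2 * poly (node_poly k) (of_nat c ^ 2)
      * poly (test_poly j ?r) (of_nat c ^ 2)))"
    by (subst sum.swap) (simp add: sum_distrib_left)
  also have "\<dots> = (\<Sum>k\<le>n. (-1) ^ n / 2 * fact j * pochhammer (?r - of_nat n) (2 * n + 2)
      * pochhammer (?r + 1 / 2 - of_nat j) (j + 1) * ((-1) ^ k * of_nat (n choose k) * (pochhammer (of_nat k + 3 / 2) n
          / pochhammer (of_nat k + 3 / 2) (j + 1) * pochhammer (?r - of_nat k - of_nat j) j)))"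
  proof (intro sum.cong refl)
    fix k assume "k \<in> {..n}"
    then have k: "k \<le> n" by simp
    define X where "X = pochhammer (?r + 1 / 2 - of_nat j) (j + 1)"
    define Y where "Y = pochhammer (of_nat k + 3 / 2) n / pochhammer (of_nat k + 3 / 2 :: rat) (j + 1)"
    have sgn: "(-1) ^ k * (-1) ^ (n - k) = ((-1) ^ n :: rat)"
      using k by (simp flip: power_add)
    have "ortho_coeff n ?r k * ((-1) ^ k / 2 * fact j * pochhammer (?r - of_nat k - of_nat j) (2 * k + j + 2)
        * X / pochhammer (of_nat k + 3 / 2) (j + 1)) =
      (pochhammer (of_nat k + 1 - ?r) (n - k) * pochhammer (of_nat k + 2 + ?r) (n - k)
      * pochhammer (?r - of_nat k - of_nat j) (2 * k + j + 2)) * ((-1) ^ k * (-1) ^ k * of_nat (n choose k) * fact j / 2 * X * Y)"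
      by (simp add: ortho_coeff_def Y_def mult_ac)
    also have "\<dots> = ((-1) ^ k * (-1) ^ (n - k)) / 2 * fact j * pochhammer (?r - of_nat n) (2 * n + 2) * X
        * ((-1) ^ k * of_nat (n choose k) * (Y * pochhammer (?r - of_nat k - of_nat j) j))"
      unfolding pochhammer_glue[OF k] by (simp add: mult_ac)
    finally show "ortho_coeff n ?r k * (\<Sum>c = 1..r. of_nat c ^ 2 * poly (node_poly k) (of_nat c ^ 2)
        * poly (test_poly j ?r) (of_nat c ^ 2)) = (-1) ^ n / 2 * fact j * pochhammer (?r - of_nat n) (2 * n + 2)
      * pochhammer (?r + 1 / 2 - of_nat j) (j + 1) * ((-1) ^ k * of_nat (n choose k) * (pochhammer (of_nat k + 3 / 2) n
          / pochhammer (of_nat k + 3 / 2) (j + 1) * pochhammer (?r - of_nat k - of_nat j) j))"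
      unfolding sum_node_poly_test_poly sgn X_def Y_def .
  qed
  finally show ?thesis by (simp add: sum_distrib_left)
qed

lemma pochhammer_pos_rat_neq_0: "(x :: rat) > 0 \<Longrightarrow> pochhammer x n \<noteq> 0"
  using pochhammer_pos[of x n] by simp

lemma sum_ortho_poly_test_poly_eq_0:
  assumes "j < n"
  shows "(\<Sum>c = 1..r. of_nat c ^ 2 * poly (ortho_poly n (of_nat r)) (of_nat c ^ 2)
      * poly (test_poly j (of_nat r)) (of_nat c ^ 2) :: rat) = 0"
proof -
  \<comment> \<open>For \<open>j < n\<close> the quotient of the two Pochhammer symbols is a
    polynomial in \<open>k\<close> of degree \<open>n-j-1\<close>. Together with the factor of
    degree \<open>j\<close> the total is \<open>n-1\<close>, so the \<open>n\<close>-th difference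
    vanishes.\<close>
  let ?f = "\<lambda>x. pochhammer (x + (3 / 2 + of_nat (j + 1))) (n - (j + 1)) * pochhammer (of_nat r - of_nat j - x) j :: rat"
  have "polyfun ((n - (j + 1)) + j) ?f"
    by (intro polyfun_mult polyfun_pochhammer polyfun_add_const polyfun_const_diff)
  then have "(\<Sum>k\<le>n. (-1) ^ k * of_nat (n choose k) * ?f (of_nat k)) = 0"
    by (rule alternating_binomial_sum_eq_0) (use assms in simp)
  also have "(\<Sum>k\<le>n. (-1) ^ k * of_nat (n choose k) * ?f (of_nat k)) =
      (\<Sum>k\<le>n. (-1) ^ k * of_nat (n choose k) * (pochhammer (of_nat k + 3 / 2) n
          / pochhammer (of_nat k + 3 / 2) (j + 1) * pochhammer (of_nat r - of_nat k - of_nat j) j))"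
  proof (intro sum.cong refl arg_cong2[of _ _ _ _ "(*)"])
    fix k
    have "pochhammer (of_nat k + 3 / 2 :: rat) (j + 1) \<noteq> 0"
      by (rule pochhammer_pos_rat_neq_0) simp
    then show "pochhammer (of_nat k + (3 / 2 + of_nat (j + 1))) (n - (j + 1)) =
        pochhammer (of_nat k + 3 / 2) n / pochhammer (of_nat k + 3 / 2 :: rat) (j + 1)"
      using pochhammer_product[of "j + 1" n "of_nat k + 3 / 2 :: rat"] assms
      by (simp add: add.assoc)
  qed (simp add: algebra_simps)
  finally show ?thesis unfolding sum_ortho_poly_test_poly by simp
qed

text \<open>For \<open>j = n\<close> the quotient is \<open>1/(k + n + 3/2)\<close>, so the partial
  fraction formula applies with \<open>y = n + 3/2\<close>. The value at \<open>- y\<close> is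
  \<open>(r+3/2)_n\<close>, which prolongs \<open>(r+1/2-n)_(n+1)\<close> to length
  \<open>2n+1\<close>.\<close>

lemma sum_ortho_poly_test_poly_same:
  "(\<Sum>c = 1..r. of_nat c ^ 2 * poly (ortho_poly n (of_nat r)) (of_nat c ^ 2)
      * poly (test_poly n (of_nat r)) (of_nat c ^ 2) :: rat) =
    (-1) ^ n / 2 * fact n ^ 2 * pochhammer (of_nat r - of_nat n) (2 * n + 2)
      * pochhammer (of_nat r + 1 / 2 - of_nat n) (2 * n + 1) / pochhammer (of_nat n + 3 / 2) (n + 1)"
proof -
  let ?y = "of_nat n + 3 / 2 :: rat"
  let ?f = "\<lambda>x. pochhammer (of_nat r - of_nat n - x) n :: rat"
  have pf: "polyfun n ?f"
    by (intro polyfun_pochhammer polyfun_const_diff)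
  have "(\<Sum>k\<le>n. (-1) ^ k * of_nat (n choose k) * (pochhammer (of_nat k + 3 / 2) n
          / pochhammer (of_nat k + 3 / 2) (n + 1) * pochhammer (of_nat r - of_nat k - of_nat n) n)) =
      (\<Sum>k\<le>n. (-1) ^ k * of_nat (n choose k) * (?f (of_nat k) / (?y + of_nat k)))"
  proof (intro sum.cong refl arg_cong2[of _ _ _ _ "(*)"])
    fix k
    have "pochhammer (of_nat k + 3 / 2 :: rat) n \<noteq> 0"
      by (rule pochhammer_pos_rat_neq_0) simp
    then show "pochhammer (of_nat k + 3 / 2) n / pochhammer (of_nat k + 3 / 2) (n + 1)
        * pochhammer (of_nat r - of_nat k - of_nat n) n = ?f (of_nat k) / (?y + of_nat k)"
      by (simp add: pochhammer_Suc diff_diff_add ac_simps)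
  qed
  also have "\<dots> = fact n * ?f (- ?y) / pochhammer ?y (n + 1)"
    by (rule alternating_binomial_sum_over_linear[OF pf]) (rule pochhammer_pos_rat_neq_0, simp)
  also have "?f (- ?y) = pochhammer (of_nat r + 3 / 2) n"
    by simp
  finally have "(\<Sum>c = 1..r. of_nat c ^ 2 * poly (ortho_poly n (of_nat r)) (of_nat c ^ 2)
      * poly (test_poly n (of_nat r)) (of_nat c ^ 2) :: rat) =
    (-1) ^ n / 2 * fact n ^ 2 * pochhammer (of_nat r - of_nat n) (2 * n + 2)
      * (pochhammer (of_nat r + 1 / 2 - of_nat n) (n + 1) * pochhammer (of_nat r + 3 / 2) n)
      / pochhammer ?y (n + 1)"
    unfolding sum_ortho_poly_test_poly by (simp add: power2_eq_square mult_ac)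
  also have "pochhammer (of_nat r + 1 / 2 - of_nat n) (n + 1) * pochhammer (of_nat r + 3 / 2) n =
      pochhammer (of_nat r + 1 / 2 - of_nat n :: rat) (2 * n + 1)"
  proof -
    have "n + 1 + n = 2 * n + 1" by simp
    then show ?thesis
      using pochhammer_product'[of "of_nat r + 1 / 2 - of_nat n :: rat" "n + 1" n]
      by (simp only: of_nat_add) (simp add: algebra_simps)
  qed
  finally show ?thesis .
qed

section \<open>From test polynomials to powers and Hankel determinants\<close>

lemma linear_functional_vanishes:
  fixes F :: "'a :: field poly \<Rightarrow> 'b :: ab_group_add" and b :: "nat \<Rightarrow> 'a poly"
  assumes add: "\<And>p q. F (p + q) = F p + F q"
    and vanish: "\<And>j a. j < n \<Longrightarrow> F (Polynomial.smult a (b j)) = 0"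
    and deg: "\<And>j. j < n \<Longrightarrow> degree (b j) = j" "\<And>j. j < n \<Longrightarrow> b j \<noteq> 0"
    and q: "\<And>i. i \<ge> n \<Longrightarrow> poly.coeff q i = 0"
  shows "F q = 0"
proof -
  have F0: "F 0 = 0" using add[of 0 0] by simp
  have "F q = 0" if "m \<le> n" "\<And>i. i \<ge> m \<Longrightarrow> poly.coeff q i = 0" for m q
    using that
  proof (induction m arbitrary: q)
    case 0
    then have "q = 0" by (intro poly_eqI) simp
    then show ?case by (simp add: F0)
  next
    case (Suc d)
    define a where "a = poly.coeff q d / lead_coeff (b d)"
    define q' where "q' = q - Polynomial.smult a (b d)"
    have d: "d < n" using Suc.prems(1) by simp
    have nz: "poly.coeff (b d) d \<noteq> 0" using deg[OF d] by (metis leading_coeff_0_iff)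
    have "F q' = 0"
    proof (rule Suc.IH)
      fix i assume "i \<ge> d"
      then show "poly.coeff q' i = 0"
        using Suc.prems(2)[of i] deg[OF d] nz
        by (cases "i = d") (auto simp: q'_def a_def coeff_eq_0)
    qed (use d in simp)
    then show ?case
      using add[of q' "Polynomial.smult a (b d)"] vanish[OF d] by (simp add: q'_def)
  qed
  from this[of n q] q show ?thesis by simp
qed

text \<open>The test polynomials have one member in each degree, so orthogonality to them passes to
  every polynomial of degree below \<open>n\<close>.\<close>

lemma sum_ortho_poly_power:
  fixes r n :: nat
  defines "L \<equiv> \<lambda>j. \<Sum>c = 1..r. of_nat c ^ 2 * poly (ortho_poly n (of_nat r)) (of_nat c ^ 2)
    * (of_nat c ^ 2) ^ j :: rat"
  shows "j < n \<Longrightarrow> L j = 0"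
    and "L n = 1 / 2 * fact n ^ 2 * pochhammer (of_nat r - of_nat n) (2 * n + 2)
      * pochhammer (of_nat r + 1 / 2 - of_nat n) (2 * n + 1) / pochhammer (of_nat n + 3 / 2) (n + 1)"
proof -
  define F where "F = (\<lambda>q. \<Sum>c = 1..r. of_nat c ^ 2 * poly (ortho_poly n (of_nat r)) (of_nat c ^ 2)
    * poly q (of_nat c ^ 2) :: rat)"
  have add: "F (p + q) = F p + F q" for p q
    by (simp add: F_def ring_distribs sum.distrib)
  have smult: "F (Polynomial.smult a q) = a * F q" for a q
    by (simp add: F_def sum_distrib_left mult_ac)
  have L: "L j = F (Polynomial.monom 1 j)" for j
    by (simp add: L_def F_def poly_monom)
  have vanish: "F q = 0" if "\<And>i. i \<ge> n \<Longrightarrow> poly.coeff q i = 0" for q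
  proof (rule linear_functional_vanishes[where F = F and n = n and b = "\<lambda>j. test_poly j (of_nat r)"])
    fix j a assume "j < n"
    then show "F (Polynomial.smult a (test_poly j (of_nat r))) = 0"
      using sum_ortho_poly_test_poly_eq_0[of j n r] unfolding smult by (simp add: F_def)
  next
    fix j assume "j < n"
    show "test_poly j (of_nat r :: rat) \<noteq> 0"
      by (metis lead_coeff_test_poly leading_coeff_0_iff power_not_zero zero_neq_neg_one)
  qed (use that add degree_test_poly in auto)
  show "L j = 0" if "j < n"
    unfolding L by (rule vanish) (use that in simp)
  \<comment> \<open>The power \<open>t^n\<close> and \<open>(-1)^n\<close> times the test polynomial
    share their leading term, so the difference has degree below \<open>n\<close> and the two norms
    agree up to sign.\<close>
  have "F (Polynomial.monom 1 n + Polynomial.smult (- ((-1) ^ n)) (test_poly n (of_nat r))) = 0"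
  proof (rule vanish)
    fix i assume "n \<le> i"
    moreover have "degree (test_poly n (of_nat r :: rat)) = n"
      "lead_coeff (test_poly n (of_nat r :: rat)) = (-1) ^ n"
      by (rule degree_test_poly lead_coeff_test_poly)+
    ultimately show "poly.coeff (Polynomial.monom 1 n +
        Polynomial.smult (- ((-1) ^ n)) (test_poly n (of_nat r :: rat))) i = 0"
      by (cases "i = n") (auto simp: coeff_eq_0 simp flip: power_mult_distrib)
  qed
  then have "L n = (-1) ^ n * F (test_poly n (of_nat r))"
    unfolding add smult L by simp
  also have "F (test_poly n (of_nat r)) = (-1) ^ n / 2 * fact n ^ 2 * pochhammer (of_nat r - of_nat n) (2 * n + 2)
      * pochhammer (of_nat r + 1 / 2 - of_nat n) (2 * n + 1) / pochhammer (of_nat n + 3 / 2) (n + 1)"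
    unfolding F_def by (rule sum_ortho_poly_test_poly_same)
  finally show "L n = 1 / 2 * fact n ^ 2 * pochhammer (of_nat r - of_nat n) (2 * n + 2)
      * pochhammer (of_nat r + 1 / 2 - of_nat n) (2 * n + 1) / pochhammer (of_nat n + 3 / 2) (n + 1)"
    by (simp flip: power_mult_distrib mult.assoc)
qed

lemma sum_coeff_times_power_sum:
  assumes "degree p \<le> n"
  shows "(\<Sum>k\<le>n. poly.coeff p k * power_sum r (2 * (k + j))) =
    (\<Sum>c = 1..r. poly p (of_nat c ^ 2) * (of_nat c ^ 2) ^ j)"
proof -
  have "poly p x = (\<Sum>k\<le>n. poly.coeff p k * x ^ k)" for x
  proof -
    have "poly p x = (\<Sum>k\<le>degree p. poly.coeff p k * x ^ k)" by (rule poly_altdef)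
    also have "\<dots> = (\<Sum>k\<le>n. poly.coeff p k * x ^ k)"
      using assms by (intro sum.mono_neutral_left) (auto simp: coeff_eq_0)
    finally show ?thesis .
  qed
  then have "(\<Sum>c = 1..r. poly p (of_nat c ^ 2) * (of_nat c ^ 2) ^ j) =
      (\<Sum>c = 1..r. \<Sum>k\<le>n. poly.coeff p k * of_nat c ^ (2 * (k + j)))"
    by (simp add: sum_distrib_right distrib_left mult.assoc flip: power_mult power_add)
  also have "\<dots> = (\<Sum>k\<le>n. poly.coeff p k * power_sum r (2 * (k + j)))"
    by (subst sum.swap) (simp add: power_sum_def sum_distrib_left)
  finally show ?thesis by simp
qed

lemma sum_coeff_ortho_poly_times_power_sum:
  fixes r n :: nat
  defines "S \<equiv> \<lambda>j. \<Sum>k\<le>n. poly.coeff (ortho_poly n (of_nat r)) k * power_sum r (2 * (k + j) + 2)"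
  shows "j < n \<Longrightarrow> S j = 0"
    and "S n = 1 / 2 * fact n ^ 2 * pochhammer (of_nat r - of_nat n) (2 * n + 2)
      * pochhammer (of_nat r + 1 / 2 - of_nat n) (2 * n + 1) / pochhammer (of_nat n + 3 / 2) (n + 1)"
proof -
  have S: "S j = (\<Sum>c = 1..r. of_nat c ^ 2 * poly (ortho_poly n (of_nat r)) (of_nat c ^ 2)
    * (of_nat c ^ 2) ^ j)" for j
    using sum_coeff_times_power_sum[OF degree_ortho_poly, of n "of_nat r" r "j + 1"]
    by (simp add: S_def mult_ac)
  show "j < n \<Longrightarrow> S j = 0"
    using sum_ortho_poly_power(1)[of j n r] S by simp
  show "S n = 1 / 2 * fact n ^ 2 * pochhammer (of_nat r - of_nat n) (2 * n + 2)
      * pochhammer (of_nat r + 1 / 2 - of_nat n) (2 * n + 1) / pochhammer (of_nat n + 3 / 2) (n + 1)"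
    unfolding S by (rule sum_ortho_poly_power(2))
qed

text \<open>Each factor is the squared norm of a monic orthogonal polynomial. The induction step
  divides only by the leading coefficient, a Pochhammer symbol at a positive argument, so
  determinants that vanish for small \<open>r\<close> do no harm.\<close>

lemma hdet_power_sum:
  "hdet N (\<lambda>k. power_sum r (2 * k + 2)) = (\<Prod>n<N. 1 / 2 * fact n ^ 2 * pochhammer (of_nat r - of_nat n) (2 * n + 2)
      * pochhammer (of_nat r + 1 / 2 - of_nat n) (2 * n + 1)
      / (pochhammer (of_nat n + 3 / 2) n * pochhammer (of_nat n + 3 / 2) (n + 1)))"
proof (induction N)
  case (Suc n)
  let ?r = "of_nat r :: rat"
  have nz: "pochhammer (of_nat n + 3 / 2 :: rat) n \<noteq> 0"
    by (rule pochhammer_pos_rat_neq_0) simp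
  have "poly.coeff (ortho_poly n ?r) n * hdet (n + 1) (\<lambda>k. power_sum r (2 * k + 2)) =
      (\<Sum>k\<le>n. poly.coeff (ortho_poly n ?r) k * power_sum r (2 * (k + n) + 2)) * hdet n (\<lambda>k. power_sum r (2 * k + 2))"
    by (rule hdet_Suc_orthogonal) (rule sum_coeff_ortho_poly_times_power_sum(1))
  then have "hdet (n + 1) (\<lambda>k. power_sum r (2 * k + 2)) =
      hdet n (\<lambda>k. power_sum r (2 * k + 2)) * (\<Sum>k\<le>n. poly.coeff (ortho_poly n ?r) k * power_sum r (2 * (k + n) + 2))
      / pochhammer (of_nat n + 3 / 2) n"
    using nz by (simp add: coeff_ortho_poly field_simps)
  then show ?case
    unfolding sum_coeff_ortho_poly_times_power_sum(2) Suc.IH by (simp add: mult_ac)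
qed simp

lemma hankel_det_power_sum_4:
  "pochhammer (of_nat n + 5 / 2) (n + 1) * hankel_det n (\<lambda>k. power_sum r (2 * k + 4)) =
    (-1) ^ (n + 1) * poly (ortho_poly (n + 1) (of_nat r)) 0 * hdet (n + 1) (\<lambda>k. power_sum r (2 * k + 2))"
proof -
  have "poly.coeff (ortho_poly (n + 1) (of_nat r)) (n + 1) * hdet (n + 1) (\<lambda>k. power_sum r (2 * (k + 1) + 2)) =
      (-1) ^ (n + 1) * poly.coeff (ortho_poly (n + 1) (of_nat r)) 0 * hdet (n + 1) (\<lambda>k. power_sum r (2 * k + 2))"
    by (rule hdet_shift_orthogonal) (rule sum_coeff_ortho_poly_times_power_sum(1))
  moreover have "2 * (k + 1) + 2 = 2 * k + (4 :: nat)" for k by simp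
  moreover have "of_nat (n + 1) + 3 / 2 = (of_nat n + 5 / 2 :: rat)" by simp
  ultimately show ?thesis
    unfolding coeff_ortho_poly by (simp only: hankel_det_eq_hdet poly_0_coeff_0)
qed

lemma det_V_mat:
  "pochhammer (of_nat n + 3 / 2) n * det (V_mat r n) =
    (-1) ^ n * (\<Sum>c = 1..r. poly (ortho_poly n (of_nat r)) (of_nat c ^ 2)) * hdet n (\<lambda>k. power_sum r (2 * k + 2))"
proof -
  have "poly.coeff (ortho_poly n (of_nat r)) n * hdet (n + 1) (\<lambda>k. power_sum r (2 * k)) =
      (-1) ^ n * (\<Sum>k\<le>n. poly.coeff (ortho_poly n (of_nat r)) k * power_sum r (2 * k))
      * hdet n (\<lambda>k. power_sum r (2 * (k + 1)))"
    by (rule hdet_Suc_orthogonal_shift)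
      (use sum_coeff_ortho_poly_times_power_sum(1)[of _ n r] in \<open>simp add: algebra_simps\<close>)
  then show ?thesis
    using sum_coeff_times_power_sum[OF degree_ortho_poly, of n "of_nat r" r 0]
    unfolding coeff_ortho_poly by (simp add: V_mat_def hdet_def algebra_simps)
qed

subsection \<open>Two values of the orthogonal polynomials\<close>

lemma fact_times_pochhammer: "fact a * pochhammer (of_nat a + 1) b = (fact (a + b) :: 'a :: field_char_0)"
  using pochhammer_product'[of "1 :: 'a" a b] by (simp add: pochhammer_fact add.commute)

lemma alternating_pochhammer_sum:
  fixes u :: "'a :: field_char_0"
  assumes mn: "m \<le> n"
  shows "(\<Sum>k = m..n. (-1) ^ k * of_nat (n choose k) * pochhammer (of_nat k + u) n
      * (fact k ^ 2 / (fact (k - m) * fact (k + m + 1)))) =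
    (-1) ^ m * fact n ^ 2 / (fact (n - m) * fact (n + m + 1))
      * (pochhammer (u - 1) (n - m) * pochhammer (u + of_nat n) m)" (is "?L u = ?R u")
proof -
  \<comment> \<open>As polynomials in \<open>u\<close> of degree \<open>n\<close>, both sides have the same \<open>n\<close> obvious zeros, and at one further
    point the left-hand side has a single nonzero term.\<close>
  have "?L = ?R"
  proof (rule polyfun_eqI)
    have "?L = (\<lambda>u. \<Sum>k = m..n. ((-1) ^ k * of_nat (n choose k) *
        (fact k ^ 2 / (fact (k - m) * fact (k + m + 1)))) * pochhammer (u + of_nat k) n)"
      by (simp add: mult_ac add.commute)
    moreover have "polyfun n \<dots>"
      by (intro polyfun_sum polyfun_cmult polyfun_pochhammer polyfun_add_const)
    ultimately show "polyfun n ?L" by simp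
    have "polyfun (n - m + m) (\<lambda>u :: 'a. pochhammer (u - 1) (n - m) * pochhammer (u + of_nat n) m)"
      using polyfun_add_const[of "- 1 :: 'a"]
      by (intro polyfun_mult polyfun_pochhammer polyfun_add_const) simp
    then show "polyfun n ?R"
      using mn by (intro polyfun_cmult) simp
    \<comment> \<open>\<open>?A\<close> consists of the roots of \<open>(u-1)_(n-m)\<close>;
      \<open>?B\<close> consists of the roots of \<open>(u+n)_m\<close> and, for
      \<open>i = m\<close>, the further point \<open>-n-m\<close>.\<close>
    let ?A = "(\<lambda>i. 1 - of_nat i :: 'a) ` {..<n - m}" and ?B = "(\<lambda>i. - of_nat n - of_nat i :: 'a) ` {..m}"
    have "card ?A = n - m" "card ?B = m + 1"
      by (simp_all add: card_image inj_on_def)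
    moreover have "?A \<inter> ?B = {}"
    proof -
      have "1 - of_nat i \<noteq> - of_nat n - (of_nat j :: 'a)" if "i < n - m" for i j
      proof
        assume "1 - of_nat i = - of_nat n - (of_nat j :: 'a)"
        then have "of_nat (1 + n + j) = (of_nat i :: 'a)" by (simp add: algebra_simps)
        then show False using that unfolding of_nat_eq_iff by simp
      qed
      then show ?thesis by auto
    qed
    ultimately show "card (?A \<union> ?B) > n"
      using mn by (subst card_Un_disjoint) auto
    fix x assume "x \<in> ?A \<union> ?B"
    then show "?L x = ?R x"
    proof
      assume "x \<in> ?A"
      then obtain i where i: "i < n - m" "x = 1 - of_nat i" by auto
      \<comment> \<open>At \<open>u = 1 - i\<close> the symbol \<open>(k+u)_n\<close> contains
        \<open>(k+1)_(m+1)\<close>, which cancels \<open>(k+m+1)!/k!\<close>, and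
        \<open>k!/(k-m)!\<close> is \<open>(k+1-m)_m\<close>. What is left is a polynomial in
        \<open>k\<close> of degree \<open>n-1\<close> that vanishes for \<open>k < m\<close>, so the
        sum may start at 0.\<close>
      let ?f = "\<lambda>y :: 'a. pochhammer (y + (1 - of_nat i)) i * (pochhammer (y + (1 - of_nat m)) m
        * pochhammer (y + (of_nat m + 2)) (n - i - (m + 1)))"
      have "polyfun (i + (m + (n - i - (m + 1)))) ?f"
        by (intro polyfun_mult polyfun_pochhammer polyfun_add_const)
      then have "(\<Sum>k\<le>n. (-1) ^ k * of_nat (n choose k) * ?f (of_nat k)) = 0"
        by (rule alternating_binomial_sum_eq_0) (use i in simp)
      also have "(\<Sum>k\<le>n. (-1) ^ k * of_nat (n choose k) * ?f (of_nat k)) =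
          (\<Sum>k = m..n. (-1) ^ k * of_nat (n choose k) * ?f (of_nat k))"
      proof (rule sum.mono_neutral_right)
        show "\<forall>k\<in>{..n} - {m..n}. (-1) ^ k * of_nat (n choose k) * ?f (of_nat k) = 0"
        proof
          fix k assume "k \<in> {..n} - {m..n}"
          then have "k < m" by auto
          then have "of_nat k + (1 - of_nat m :: 'a) = - of_nat (m - Suc k)"
            by (simp add: of_nat_diff algebra_simps)
          moreover have "m - Suc k < m" using \<open>k < m\<close> by simp
          ultimately have "pochhammer (of_nat k + (1 - of_nat m :: 'a)) m = 0"
            by (simp only: pochhammer_of_nat_eq_0_lemma)
          then show "(-1) ^ k * of_nat (n choose k) * ?f (of_nat k) = 0" by simp
        qed
      qed auto
      also have "\<dots> = ?L x"
      proof (intro sum.cong refl)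
        fix k assume "k \<in> {m..n}"
        then have k: "m \<le> k" by simp
        have "pochhammer (of_nat k + x) n =
            pochhammer (of_nat k + x) i * pochhammer (of_nat k + 1) (n - i)"
          using pochhammer_product[of i n "of_nat k + x"] i(1) by (simp add: i(2) add.assoc)
        also have "pochhammer (of_nat k + 1) (n - i) = pochhammer (of_nat k + 1) (m + 1) *
            pochhammer (of_nat k + (of_nat m + 2) :: 'a) (n - i - (m + 1))"
          using pochhammer_product[of "m + 1" "n - i" "of_nat k + 1 :: 'a"] i by (simp add: algebra_simps)
        finally have 1: "pochhammer (of_nat k + x) n = pochhammer (of_nat k + x) i *
          (pochhammer (of_nat k + 1) (m + 1) * pochhammer (of_nat k + (of_nat m + 2) :: 'a) (n - i - (m + 1)))" .
        have 2: "fact (k + m + 1) = fact k * pochhammer (of_nat k + 1 :: 'a) (m + 1)"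
          using fact_times_pochhammer[of k "m + 1", where 'a = 'a] by (simp add: add.assoc)
        have 3: "fact k = fact (k - m) * pochhammer (of_nat k + (1 - of_nat m) :: 'a) m"
          using fact_times_pochhammer[of "k - m" m, where 'a = 'a] k by (simp add: of_nat_diff algebra_simps)
        have nz: "pochhammer (of_nat k + 1 :: 'a) (m + 1) \<noteq> 0"
          using 2 by (metis fact_nonzero mult_zero_right)
        have "fact k ^ 2 / (fact (k - m) * fact (k + m + 1)) =
            pochhammer (of_nat k + (1 - of_nat m) :: 'a) m / pochhammer (of_nat k + 1) (m + 1)"
          unfolding 2 power2_eq_square by (subst (1) 3) simp
        then show "(-1) ^ k * of_nat (n choose k) * ?f (of_nat k) =
          (-1) ^ k * of_nat (n choose k) * pochhammer (of_nat k + x) n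
            * (fact k ^ 2 / (fact (k - m) * fact (k + m + 1)))"
          using nz unfolding 1 by (simp add: i(2))
      qed
      finally have "?L x = 0" by simp
      moreover have "pochhammer (x - 1) (n - m) = 0"
        using pochhammer_of_nat_eq_0_lemma[of i "n - m", where 'a = 'a] i by simp
      ultimately show ?thesis by simp
    next
      assume "x \<in> ?B"
      then obtain i where i: "i \<le> m" "x = - of_nat n - of_nat i" by auto
      \<comment> \<open>Here \<open>k + x\<close> is \<open>-(n+i-k)\<close>, so a symbol of length
        \<open>n\<close> runs through 0 exactly when \<open>i < k\<close>. For \<open>i = m\<close>
        only the term \<open>k = m\<close> escapes.\<close>
      have zero: "pochhammer (of_nat k + x) n = 0" if "k \<in> {m..n}" "k \<noteq> m \<or> i < m" for k
      proof -
        have k: "i < k" "k \<le> n" using that i(1) by auto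
        then have "of_nat k + x = - of_nat (n + i - k)"
          by (simp add: i(2) of_nat_diff algebra_simps)
        moreover have "n + i - k < n" using k by simp
        ultimately show ?thesis
          by (simp only: pochhammer_of_nat_eq_0_lemma)
      qed
      show ?thesis
      proof (cases "i < m")
        case True
        have "?L x = 0"
          by (rule sum.neutral) (use zero True in auto)
        moreover have "pochhammer (x + of_nat n) m = 0"
          using pochhammer_of_nat_eq_0_lemma[of i m, where 'a = 'a] True by (simp add: i(2))
        ultimately show ?thesis by simp
      next
        case False
        then have x: "x = - of_nat n - of_nat m" using i by simp
        have "?L x = (-1) ^ m * of_nat (n choose m) * pochhammer (of_nat m + x) n
            * (fact m ^ 2 / (fact (m - m) * fact (m + m + 1)))"
          using mn by (subst sum.remove[of _ m]) (auto intro!: sum.neutral simp: zero)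
        also have "of_nat m + x = - of_nat n" by (simp add: x)
        also have "pochhammer (- of_nat n :: 'a) n = (-1) ^ n * fact n"
          by (rule pochhammer_same)
        also have "of_nat (n choose m) = (fact n / (fact m * fact (n - m)) :: 'a)"
          using mn by (rule binomial_fact)
        finally have L: "?L x = (-1) ^ m * (fact n / (fact m * fact (n - m))) * ((-1) ^ n * fact n)
            * (fact m ^ 2 / (fact (m - m) * fact (m + m + 1)))" .
        have "x - 1 = - (of_nat n + of_nat m + 1)" by (simp add: x)
        moreover have "of_nat n + of_nat m + 1 - of_nat (n - m) + 1 = of_nat (m + m + 1) + (1 :: 'a)"
          using mn by (simp add: of_nat_diff)
        ultimately have "pochhammer (x - 1) (n - m) = (-1) ^ (n - m) * pochhammer (of_nat (m + m + 1) + 1) (n - m)"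
          by (simp only: pochhammer_minus)
        moreover have "fact (m + m + 1) * pochhammer (of_nat (m + m + 1) + 1) (n - m) = (fact (n + m + 1) :: 'a)"
          using mn by (subst fact_times_pochhammer) (simp add: algebra_simps)
        ultimately have P: "pochhammer (x - 1) (n - m) = (-1) ^ (n - m) * (fact (n + m + 1) / fact (m + m + 1))"
          by (simp add: field_simps del: fact_Suc of_nat_add)
        have Q: "pochhammer (x + of_nat n) m = (-1) ^ m * fact m"
          by (simp add: x pochhammer_same)
        have sgn: "(-1 :: 'a) ^ n = (-1) ^ (n - m) * (-1) ^ m"
          using mn by (simp flip: power_add)
        show ?thesis
          unfolding L P Q sgn by (simp add: power2_eq_square del: fact_Suc)
      qed
    qed
  qed
  then show ?thesis by (rule fun_cong)
qed

section \<open>The value at 0 as a polynomial in \<open>r\<close>\<close>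

lemma poly_node_poly_0: "poly (node_poly k) 0 = fact k ^ 2"
  by (simp add: node_poly_def poly_prod fact_prod prod_power_distrib)

text \<open>The symbol \<open>(k+1-r)_(n-k)\<close> runs through 0 at \<open>r = m\<close>. This
  truncation to \<open>k \<ge> m\<close> is what makes the values at the small nodes
  computable.\<close>

lemma ortho_coeff_of_nat_eq_0:
  assumes "k < m" "m \<le> n"
  shows "ortho_coeff n (of_nat m :: 'a :: field_char_0) k = 0"
proof -
  have "of_nat k + 1 - of_nat m = - (of_nat (m - Suc k) :: 'a)"
    using assms by (simp add: of_nat_diff algebra_simps)
  moreover have "m - Suc k < n - k" using assms by simp
  ultimately have "pochhammer (of_nat k + 1 - of_nat m :: 'a) (n - k) = 0"
    by (simp only: pochhammer_of_nat_eq_0_lemma)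
  then show ?thesis by (simp add: ortho_coeff_def)
qed

lemma ortho_coeff_reflect: "ortho_coeff n (- 1 - r) k = ortho_coeff n r k"
  by (simp add: ortho_coeff_def algebra_simps)

lemma ortho_poly_reflect: "ortho_poly n (- 1 - r) = ortho_poly n r"
  by (simp add: ortho_poly_def ortho_coeff_reflect)

text \<open>At \<open>r = m\<close> the two symbols that depend on \<open>r\<close> are quotients of
  factorials, and the truncated sum is \<open>alternating_pochhammer_sum\<close> at
  \<open>u = 3/2\<close>.\<close>

lemma ortho_poly_of_nat_0:
  assumes "m \<le> n"
  shows "poly (ortho_poly n (of_nat m)) 0 =
    (-1) ^ m * fact n ^ 2 * pochhammer (1 / 2) (n - m) * pochhammer (of_nat n + 3 / 2) m"
proof -
  have "poly (ortho_poly n (of_nat m)) (0 :: 'a :: field_char_0) =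
      (\<Sum>k = m..n. ortho_coeff n (of_nat m) k * fact k ^ 2)"
    unfolding poly_ortho_poly poly_node_poly_0
    using ortho_coeff_of_nat_eq_0[of _ m n, where 'a = 'a] assms
    by (intro sum.mono_neutral_right) (auto simp: not_le)
  also have "\<dots> = (\<Sum>k = m..n. (fact (n - m) * fact (n + m + 1)) *
      ((-1) ^ k * of_nat (n choose k) * pochhammer (of_nat k + 3 / 2) n
      * (fact k ^ 2 / (fact (k - m) * fact (k + m + 1)))))"
  proof (intro sum.cong refl)
    fix k assume "k \<in> {m..n}"
    then have k: "m \<le> k" "k \<le> n" by auto
    have "fact (k - m) * pochhammer (of_nat k + 1 - of_nat m :: 'a) (n - k) = fact (n - m)"
      using fact_times_pochhammer[of "k - m" "n - k", where 'a = 'a] k by (simp add: of_nat_diff algebra_simps)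
    then have 1: "pochhammer (of_nat k + 1 - of_nat m :: 'a) (n - k) = fact (n - m) / fact (k - m)"
      by (simp add: field_simps)
    have "fact (k + m + 1) * pochhammer (of_nat k + 2 + of_nat m :: 'a) (n - k) = fact (n + m + 1)"
      using fact_times_pochhammer[of "k + m + 1" "n - k", where 'a = 'a] k
      by (simp add: algebra_simps del: fact_Suc)
    then have 2: "pochhammer (of_nat k + 2 + of_nat m :: 'a) (n - k) = fact (n + m + 1) / fact (k + m + 1)"
      by (simp add: field_simps del: fact_Suc)
    show "ortho_coeff n (of_nat m) k * fact k ^ 2 = (fact (n - m) * fact (n + m + 1)) *
      ((-1) ^ k * of_nat (n choose k) * pochhammer (of_nat k + 3 / 2 :: 'a) n
      * (fact k ^ 2 / (fact (k - m) * fact (k + m + 1))))"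
      unfolding ortho_coeff_def 1 2 by (simp add: mult_ac del: fact_Suc)
  qed
  also have "\<dots> = fact (n - m) * fact (n + m + 1) * ((-1) ^ m * fact n ^ 2 / (fact (n - m) * fact (n + m + 1))
      * (pochhammer (3 / 2 - 1) (n - m) * pochhammer (3 / 2 + of_nat n) m))"
    unfolding sum_distrib_left[symmetric] alternating_pochhammer_sum[OF assms] ..
  finally show ?thesis by (simp add: add.commute mult.assoc del: fact_Suc)
qed

lemma card_reflection_nodes:
  "card (of_nat ` {..n} \<union> (\<lambda>m. - 1 - of_nat m) ` {..n} :: 'a :: field_char_0 set) = 2 * n + 2"
proof -
  let ?A = "of_nat ` {..n} :: 'a set" and ?B = "(\<lambda>m. - 1 - of_nat m :: 'a) ` {..n}"
  have "of_nat i \<noteq> - 1 - (of_nat j :: 'a)" for i j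
  proof
    assume "of_nat i = - 1 - (of_nat j :: 'a)"
    then have "of_nat (Suc (i + j)) = (0 :: 'a)" by (simp add: algebra_simps)
    then show False unfolding of_nat_eq_0_iff by simp
  qed
  then have "?A \<inter> ?B = {}" by auto
  moreover have "card ?A = n + 1" "card ?B = n + 1"
    by (simp_all add: card_image inj_on_def)
  ultimately show ?thesis by (subst card_Un_disjoint) auto
qed

lemma pochhammer_half_split:
  assumes "m \<le> n"
  shows "pochhammer (1 / 2 :: 'a :: field_char_0) (n - m) * pochhammer (of_nat n - of_nat m + 1 / 2) (m + 1)
    = 1 / 2 * pochhammer (3 / 2) n"
proof -
  have "pochhammer (1 / 2 :: 'a) ((n - m) + (m + 1)) =
      pochhammer (1 / 2) (n - m) * pochhammer (of_nat n - of_nat m + 1 / 2) (m + 1)"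
    unfolding pochhammer_product' using assms by (simp add: of_nat_diff add.commute)
  moreover have "(n - m) + (m + 1) = Suc n" using assms by simp
  ultimately show ?thesis by (simp add: pochhammer_rec)
qed

lemma prod_of_nat_add_except:
  assumes "m \<le> n"
  shows "(\<Prod>j\<in>{..n} - {m}. of_nat m + of_nat j + 1 :: 'a :: field_char_0) =
    fact (n + m + 1) / (fact m * of_nat (2 * m + 1))"
proof -
  have "fact (m + (n + 1)) = fact m * (\<Prod>j\<le>n. of_nat m + of_nat j + 1 :: 'a)"
    using fact_times_pochhammer[of m "n + 1", where 'a = 'a]
    by (simp add: pochhammer_Suc_prod atLeast0AtMost algebra_simps)
  also have "(\<Prod>j\<le>n. of_nat m + of_nat j + 1 :: 'a) =
      of_nat (2 * m + 1) * (\<Prod>j\<in>{..n} - {m}. of_nat m + of_nat j + 1)"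
    using assms by (subst prod.remove[of _ m]) auto
  finally show ?thesis
    by (simp add: field_simps del: fact_Suc of_nat_Suc of_nat_add of_nat_mult)
qed

lemma sum_mult_prod_except_eq:
  fixes f :: "nat \<Rightarrow> nat \<Rightarrow> 'a :: comm_semiring_1"
  assumes "m \<le> n" and "f m m = 0"
  shows "(\<Sum>k\<le>n. a k * (\<Prod>j\<in>{..n} - {k}. f j m)) = a m * (\<Prod>j\<in>{..n} - {m}. f j m)"
proof -
  have "(\<Sum>k\<in>{..n} - {m}. a k * (\<Prod>j\<in>{..n} - {k}. f j m)) = 0"
  proof (intro sum.neutral ballI)
    fix k assume "k \<in> {..n} - {m}"
    then have "(\<Prod>j\<in>{..n} - {k}. f j m) = 0"
      using assms by (intro prod_zero) (auto intro!: bexI[of _ m])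
    then show "a k * (\<Prod>j\<in>{..n} - {k}. f j m) = 0" by simp
  qed
  then show ?thesis using assms(1) by (subst sum.remove[of _ m]) auto
qed

text \<open>By the reflection symmetry this is a polynomial of degree at most \<open>n\<close> in
  \<open>r(r+1)\<close>. As \<open>(r-j)(r+j+1) = r(r+1) - j(j+1)\<close>, the right side is its
  Lagrange formula at the nodes \<open>j(j+1)\<close>. Counted in \<open>r\<close>, the degree is at
  most \<open>2n\<close>, and the reflected nodes give \<open>2n+2\<close> points.\<close>

lemma ortho_poly_0:
  fixes r :: rat
  shows "poly (ortho_poly n r) 0 = (-1) ^ n / 2 * fact n ^ 2 * pochhammer (3 / 2) n *
    (\<Sum>m\<le>n. of_nat (2 * m + 1) * pochhammer (of_nat n + 3 / 2) m
      / (pochhammer (of_nat n - of_nat m + 1 / 2) (m + 1) * fact (n - m) * fact (n + m + 1))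
      * (\<Prod>j\<in>{..n} - {m}. (r - of_nat j) * (r + of_nat j + 1)))"
    (is "_ = ?R r")
proof -
  define A :: "nat \<Rightarrow> rat" where "A = (\<lambda>m. of_nat (2 * m + 1) * pochhammer (of_nat n + 3 / 2) m
      / (pochhammer (of_nat n - of_nat m + 1 / 2) (m + 1) * fact (n - m) * fact (n + m + 1)))"
  define P :: "nat \<Rightarrow> rat \<Rightarrow> rat" where "P = (\<lambda>m r. \<Prod>j\<in>{..n} - {m}. (r - of_nat j) * (r + of_nat j + 1))"
  have P_reflect: "P m (- 1 - r) = P m r" for m r
    unfolding P_def by (intro prod.cong) (auto simp: algebra_simps)
  have R: "?R r = (-1) ^ n / 2 * fact n ^ 2 * pochhammer (3 / 2) n * (\<Sum>m\<le>n. A m * P m r)" for r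
    by (simp add: A_def P_def)
  have at_nat: "poly (ortho_poly n (of_nat m)) 0 = ?R (of_nat m)" if m: "m \<le> n" for m
  proof -
    have "(\<Sum>k\<le>n. A k * P k (of_nat m)) = A m * P m (of_nat m)"
      unfolding P_def using m
      by (rule sum_mult_prod_except_eq[where f = "\<lambda>j m. (of_nat m - of_nat j) * (of_nat m + of_nat j + 1)"]) simp
    also have "P m (of_nat m) = (\<Prod>j\<in>{..n} - {m}. - (of_nat j - of_nat m)) *
        (\<Prod>j\<in>{..n} - {m}. of_nat m + of_nat j + 1)"
      unfolding P_def prod.distrib[symmetric] by simp
    also have "(\<Prod>j\<in>{..n} - {m}. - (of_nat j - of_nat m :: rat)) = (-1) ^ n * ((-1) ^ m * fact m * fact (n - m))"
      using m by (subst prod_uminus) (simp add: prod_of_nat_diff_except)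
    also have "(\<Prod>j\<in>{..n} - {m}. of_nat m + of_nat j + 1 :: rat) = fact (n + m + 1) / (fact m * of_nat (2 * m + 1))"
      using m by (rule prod_of_nat_add_except)
    also have "A m * ((-1) ^ n * ((-1) ^ m * fact m * fact (n - m)) * (fact (n + m + 1) / (fact m * of_nat (2 * m + 1)))) =
        (-1) ^ n * (-1) ^ m * pochhammer (of_nat n + 3 / 2) m / pochhammer (of_nat n - of_nat m + 1 / 2) (m + 1)"
      unfolding A_def by (simp del: fact_Suc of_nat_Suc of_nat_add of_nat_mult)
    finally have "?R (of_nat m) = (-1) ^ m * fact n ^ 2 * pochhammer (of_nat n + 3 / 2) m *
        ((1 / 2 * pochhammer (3 / 2) n) / pochhammer (of_nat n - of_nat m + 1 / 2) (m + 1))"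
      unfolding R by (simp flip: power_mult_distrib)
    also have "(1 / 2 * pochhammer (3 / 2) n) / pochhammer (of_nat n - of_nat m + 1 / 2) (m + 1) =
        pochhammer (1 / 2 :: rat) (n - m)"
    proof -
      have "(of_nat n - of_nat m + 1 / 2 :: rat) > 0"
        using m by (simp add: add_nonneg_pos)
      then have "pochhammer (of_nat n - of_nat m + 1 / 2 :: rat) (m + 1) \<noteq> 0"
        by (rule pochhammer_pos_rat_neq_0)
      then show ?thesis unfolding pochhammer_half_split[OF m, symmetric] by simp
    qed
    finally show ?thesis
      unfolding ortho_poly_of_nat_0[OF m] by (simp add: mult_ac)
  qed
  have "(\<lambda>r. poly (ortho_poly n r) 0) = ?R"
  proof (rule polyfun_eqI)
    have "polyfun (2 * n) (\<lambda>r :: rat. ((-1) ^ k * of_nat (n choose k) * pochhammer (of_nat k + 3 / 2) n * fact k ^ 2) *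
        (pochhammer ((of_nat k + 1) - r) (n - k) * pochhammer (r + (of_nat k + 2)) (n - k)))" if "k \<in> {..n}" for k
      using that by (intro polyfun_cmult polyfun_mono[OF polyfun_mult[OF
            polyfun_pochhammer[OF polyfun_const_diff] polyfun_pochhammer[OF polyfun_add_const]]]) auto
    then have "polyfun (2 * n) (\<lambda>r :: rat. \<Sum>k\<le>n. ((-1) ^ k * of_nat (n choose k) * pochhammer (of_nat k + 3 / 2) n * fact k ^ 2) *
        (pochhammer ((of_nat k + 1) - r) (n - k) * pochhammer (r + (of_nat k + 2)) (n - k)))"
      by (rule polyfun_sum)
    then show "polyfun (2 * n) (\<lambda>r :: rat. poly (ortho_poly n r) 0)"
      by (simp add: poly_ortho_poly ortho_coeff_def poly_node_poly_0 mult_ac add_ac)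
    have "polyfun (\<Sum>j\<in>{..n} - {m}. 2) (P m)" for m
      unfolding P_def
    proof (rule polyfun_prod)
      fix j
      show "polyfun 2 (\<lambda>r :: rat. (r - of_nat j) * (r + of_nat j + 1))"
        using polyfun_mult[OF polyfun_add_const[of "- of_nat j"] polyfun_add_const[of "of_nat j + 1"]]
        by (simp add: add.assoc numeral_2_eq_2)
    qed
    note * = this
    have "polyfun (2 * n) (P m)" if "m \<in> {..n}" for m
      using *[of m] that by (simp add: mult.commute)
    then have "polyfun (2 * n) (\<lambda>r. (-1) ^ n / 2 * fact n ^ 2 * pochhammer (3 / 2) n * (\<Sum>m\<le>n. A m * P m r))"
      by (intro polyfun_cmult polyfun_sum)
    then show "polyfun (2 * n) ?R" unfolding R .
    show "card (of_nat ` {..n} \<union> (\<lambda>m. - 1 - of_nat m) ` {..n} :: rat set) > 2 * n"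
      unfolding card_reflection_nodes by simp
    fix x :: rat
    assume "x \<in> of_nat ` {..n} \<union> (\<lambda>m. - 1 - of_nat m) ` {..n}"
    then consider m where "m \<le> n" "x = of_nat m" | m where "m \<le> n" "x = - 1 - of_nat m" by auto
    then show "poly (ortho_poly n x) 0 = ?R x"
    proof cases
      case 1
      then show ?thesis using at_nat by simp
    next
      case 2
      then show ?thesis using at_nat[of m] unfolding R by (simp add: ortho_poly_reflect P_reflect)
    qed
  qed
  then show ?thesis by (rule fun_cong)
qed

lemma fact_double_four: "fact (2 * k) = (4 ^ k * pochhammer (1 / 2) k * fact k :: 'a :: field_char_0)"
  using fact_double[of k, where 'a = 'a] by (simp add: power_mult)

text \<open>The sum extends to a polynomial \<open>T\<close> in \<open>r\<close> of degree at most
  \<open>2n+1\<close>. It vanishes at \<open>0..n\<close>, hence the factor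
  \<open>(r-n)_(n+1)\<close>; at \<open>-1-m\<close> it is minus the value of
  \<open>ortho_poly_of_nat_0\<close>, and the cofactor is interpolated at these nodes.\<close>

lemma sum_ortho_poly_squares:
  "(\<Sum>c = 1..r. poly (ortho_poly n (of_nat r)) (of_nat c ^ 2)) =
    (-1) ^ n * 2 * fact n ^ 2 / (4 ^ (2 * n + 1) * pochhammer (3 / 2) n) * pochhammer (of_nat r - of_nat n) (n + 1) *
    (\<Sum>m\<le>n. fact (2 * n + 2 * m + 2) * fact (2 * n - 2 * m) / (fact (n + m + 1) ^ 2 * fact (n - m) ^ 2)
      * (\<Prod>j\<in>{..n} - {m}. of_nat r + of_nat j + 1 :: rat))"
proof -
  define B :: "nat \<Rightarrow> rat" where "B = (\<lambda>m. fact (2 * n + 2 * m + 2) * fact (2 * n - 2 * m) /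
      (fact (n + m + 1) ^ 2 * fact (n - m) ^ 2))"
  define C :: rat where "C = (-1) ^ n * 2 * fact n ^ 2 / (4 ^ (2 * n + 1) * pochhammer (3 / 2) n)"
  define R where "R = (\<lambda>r. C * pochhammer (r - of_nat n) (n + 1) *
    (\<Sum>m\<le>n. B m * (\<Prod>j\<in>{..n} - {m}. r + of_nat j + 1)))"
  have "\<exists>E :: rat \<Rightarrow> rat. polyfun (2 * k + 1) E \<and> E 0 = 0 \<and> (\<forall>x. E x - E (x - 1) = poly (node_poly k) (x\<^sup>2))" for k
  proof -
    have "polyfun (\<Sum>i = 1..k. 2) (\<lambda>x :: rat. \<Prod>i = 1..k. of_nat i ^ 2 - x\<^sup>2)"
    proof (rule polyfun_prod)
      fix i
      show "polyfun 2 (\<lambda>x :: rat. of_nat i ^ 2 - x\<^sup>2)"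
        unfolding polyfun_def
        by (rule exI[of _ "[:of_nat i ^ 2, 0, -1:]"]) (auto simp: power2_eq_square)
    qed
    then have "polyfun (2 * k) (\<lambda>x :: rat. poly (node_poly k) (x\<^sup>2))"
      by (simp add: poly_node_poly mult.commute)
    then obtain F :: "rat \<Rightarrow> rat" where "polyfun (2 * k + 1) F" "F 0 = 0"
      "\<And>x. F x - F (x - 1) = poly (node_poly k) (x\<^sup>2)"
      using polyfun_antidifference by blast
    then show ?thesis by blast
  qed
  then obtain E :: "nat \<Rightarrow> rat \<Rightarrow> rat" where E: "\<And>k. polyfun (2 * k + 1) (E k)" "\<And>k. E k 0 = 0"
    "\<And>k x. E k x - E k (x - 1) = poly (node_poly k) (x\<^sup>2)"
    by metis
  have E_nat: "E k (of_nat r) = (\<Sum>c = 1..r. poly (node_poly k) (of_nat c ^ 2))" for k r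
  proof (induction r)
    case (Suc r)
    then show ?case using E(3)[of k "of_nat (Suc r)"] by (simp add: algebra_simps)
  qed (simp add: E)
  \<comment> \<open>The differences of \<open>E k\<close> are even in \<open>x\<close>, so summing
    backwards through 0 repeats the forward sum with opposite sign, plus the extra term at
    \<open>c = 0\<close>.\<close>
  have E_neg: "E k (- 1 - of_nat m) = - E k (of_nat m) - poly (node_poly k) 0" for k m
  proof (induction m)
    case 0
    then show ?case using E(3)[of k 0] by (simp add: E(2))
  next
    case (Suc m)
    have "(- 1 - of_nat m :: rat)\<^sup>2 = (of_nat (Suc m))\<^sup>2" for m
      by (simp add: power2_eq_square algebra_simps)
    then have "E k (- 1 - of_nat m) - E k (- 1 - of_nat (Suc m)) = E k (of_nat (Suc m)) - E k (of_nat m)"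
      using E(3)[of k "- 1 - of_nat m"] E(3)[of k "of_nat (Suc m)"] by (simp add: algebra_simps)
    then show ?case unfolding Suc.IH by simp
  qed
  define T where "T = (\<lambda>r. \<Sum>k\<le>n. ortho_coeff n r k * E k r)"
  have T_nat: "T (of_nat r) = (\<Sum>c = 1..r. poly (ortho_poly n (of_nat r)) (of_nat c ^ 2))" for r
    unfolding T_def poly_ortho_poly E_nat by (subst sum.swap) (simp add: sum_distrib_left)
  \<comment> \<open>For \<open>k < m\<close> the coefficient vanishes; for \<open>k \<ge> m\<close>
    all of \<open>1..m\<close> are roots of \<open>node_poly k\<close>, so \<open>E k\<close>
    vanishes.\<close>
  have T_0: "T (of_nat m) = 0" if "m \<le> n" for m
    unfolding T_def
  proof (rule sum.neutral, rule ballI)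
    fix k assume "k \<in> {..n}"
    show "ortho_coeff n (of_nat m) k * E k (of_nat m) = 0"
    proof (cases "k < m")
      case True
      then show ?thesis using that ortho_coeff_of_nat_eq_0[of k m n, where 'a = rat] by simp
    next
      case False
      have "E k (of_nat m) = 0"
        unfolding E_nat
        by (rule sum.neutral) (use False in \<open>auto simp: poly_node_poly intro!: prod_zero\<close>)
      then show ?thesis by simp
    qed
  qed
  have T_neg: "T (- 1 - of_nat m) = - ((-1) ^ m * fact n ^ 2 * pochhammer (1 / 2) (n - m) * pochhammer (of_nat n + 3 / 2) m)"
    if "m \<le> n" for m
  proof -
    have "T (- 1 - of_nat m) = - T (of_nat m) - poly (ortho_poly n (of_nat m)) 0"
      by (simp add: T_def ortho_coeff_reflect E_neg poly_ortho_poly right_diff_distrib sum_subtractf sum_negf)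
    then show ?thesis using that by (simp add: T_0 ortho_poly_of_nat_0)
  qed
  have R_neg: "R (- 1 - of_nat m) = T (- 1 - of_nat m)" if m: "m \<le> n" for m
  proof -
    have "R (- 1 - of_nat m) = C * pochhammer (- 1 - of_nat m - of_nat n) (n + 1) *
        (\<Sum>k\<le>n. B k * (\<Prod>j\<in>{..n} - {k}. of_nat j - of_nat m))"
      unfolding R_def by (intro arg_cong2[of _ _ _ _ "(*)"] sum.cong prod.cong) auto
    also have "(\<Sum>k\<le>n. B k * (\<Prod>j\<in>{..n} - {k}. of_nat j - of_nat m)) = B m * (\<Prod>j\<in>{..n} - {m}. of_nat j - of_nat m)"
      using m by (rule sum_mult_prod_except_eq[where f = "\<lambda>j m. of_nat j - of_nat m"]) simp
    also have "(\<Prod>j\<in>{..n} - {m}. of_nat j - of_nat m :: rat) = (-1) ^ m * fact m * fact (n - m)"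
      using m by (rule prod_of_nat_diff_except)
    also have "pochhammer (- 1 - of_nat m - of_nat n :: rat) (n + 1) = - ((-1) ^ n * (fact (n + m + 1) / fact m))"
    proof -
      have "- 1 - of_nat m - of_nat n = - (of_nat m + of_nat n + 1 :: rat)" by simp
      moreover have "of_nat m + of_nat n + 1 - of_nat (n + 1) + 1 = (of_nat m + 1 :: rat)" by simp
      ultimately have "pochhammer (- 1 - of_nat m - of_nat n :: rat) (n + 1) = (-1) ^ (n + 1) * pochhammer (of_nat m + 1) (n + 1)"
        by (simp only: pochhammer_minus)
      moreover have "fact m * pochhammer (of_nat m + 1 :: rat) (n + 1) = fact (n + m + 1)"
        unfolding fact_times_pochhammer by (simp add: add_ac)
      ultimately show ?thesis by (simp add: field_simps del: fact_Suc)
    qed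
    \<comment> \<open>Both factorials of even numbers are split by the duplication formula. The
      powers of 4 multiply to \<open>4^(2n+1)\<close> for every \<open>m\<close>, which is why
      \<open>C\<close> can absorb them.\<close>
    also have "B m = 4 ^ (2 * n + 1) * (pochhammer (1 / 2) (n + m + 1) * pochhammer (1 / 2) (n - m) / (fact (n + m + 1) * fact (n - m)))"
    proof -
      have "2 * n + 2 * m + 2 = 2 * (n + m + 1)" "2 * n - 2 * m = 2 * (n - m)" by simp_all
      then have "fact (2 * n + 2 * m + 2) = (4 ^ (n + m + 1) * pochhammer (1 / 2) (n + m + 1) * fact (n + m + 1) :: rat)"
        "fact (2 * n - 2 * m) = (4 ^ (n - m) * pochhammer (1 / 2) (n - m) * fact (n - m) :: rat)"
        by (simp_all only: fact_double_four)
      moreover have "(4 :: rat) ^ (n + m + 1) * 4 ^ (n - m) = 4 ^ (2 * n + 1)"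
        using m by (simp flip: power_add)
      ultimately show ?thesis
        unfolding B_def by (simp add: power2_eq_square mult_ac del: fact_Suc power_Suc)
    qed
    also have "pochhammer (1 / 2) (n + m + 1) = 1 / 2 * (pochhammer (3 / 2) n * pochhammer (of_nat n + 3 / 2 :: rat) m)"
      using pochhammer_rec[of "1 / 2 :: rat" "n + m"] pochhammer_product'[of "3 / 2 :: rat" n m] by (simp add: add.commute)
    finally have "R (- 1 - of_nat m) = C * - ((-1) ^ n * (fact (n + m + 1) / fact m)) *
      (4 ^ (2 * n + 1) * (1 / 2 * (pochhammer (3 / 2) n * pochhammer (of_nat n + 3 / 2) m) * pochhammer (1 / 2) (n - m) /
       (fact (n + m + 1) * fact (n - m))) * ((-1) ^ m * fact m * fact (n - m)))" .
    also have "\<dots> = - ((-1) ^ n * (-1) ^ n * (-1) ^ m * fact n ^ 2 * pochhammer (1 / 2) (n - m) * pochhammer (of_nat n + 3 / 2) m)"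
      unfolding C_def using pochhammer_pos_rat_neq_0[of "3 / 2" n] by (simp del: fact_Suc power_Suc)
    finally show ?thesis unfolding T_neg[OF m] by (simp flip: power_mult_distrib)
  qed
  have "T = R"
  proof (rule polyfun_eqI)
    have "polyfun (2 * n + 1) (\<lambda>r :: rat. ((-1) ^ k * of_nat (n choose k) * pochhammer (of_nat k + 3 / 2) n) *
        ((pochhammer ((of_nat k + 1) - r) (n - k) * pochhammer (r + (of_nat k + 2)) (n - k)) * E k r))" if "k \<in> {..n}" for k
      using that by (intro polyfun_cmult polyfun_mono[OF polyfun_mult[OF polyfun_mult[OF
            polyfun_pochhammer[OF polyfun_const_diff] polyfun_pochhammer[OF polyfun_add_const]] E(1)]]) auto
    then have "polyfun (2 * n + 1) (\<lambda>r :: rat. \<Sum>k\<le>n. ((-1) ^ k * of_nat (n choose k) * pochhammer (of_nat k + 3 / 2) n) *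
        ((pochhammer ((of_nat k + 1) - r) (n - k) * pochhammer (r + (of_nat k + 2)) (n - k)) * E k r))"
      by (rule polyfun_sum)
    then show "polyfun (2 * n + 1) T"
      unfolding T_def by (simp add: ortho_coeff_def mult_ac add_ac)
    have "polyfun (\<Sum>j\<in>{..n} - {m}. 1) (\<lambda>r :: rat. \<Prod>j\<in>{..n} - {m}. r + of_nat j + 1)" for m
      by (rule polyfun_prod) (simp only: add.assoc polyfun_add_const)
    note * = this
    have "polyfun n (\<lambda>r :: rat. \<Prod>j\<in>{..n} - {m}. r + of_nat j + 1)" if "m \<in> {..n}" for m
      using *[of m] that by simp
    then have "polyfun ((n + 1) + n) R"
      unfolding R_def using polyfun_add_const[of "- of_nat n :: rat"]
      by (intro polyfun_mult polyfun_cmult polyfun_sum polyfun_pochhammer) auto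
    then show "polyfun (2 * n + 1) R" by (simp add: mult_2)
    show "card (of_nat ` {..n} \<union> (\<lambda>m. - 1 - of_nat m) ` {..n} :: rat set) > 2 * n + 1"
      unfolding card_reflection_nodes by simp
    fix x :: rat
    assume "x \<in> of_nat ` {..n} \<union> (\<lambda>m. - 1 - of_nat m) ` {..n}"
    then consider m where "m \<le> n" "x = of_nat m" | m where "m \<le> n" "x = - 1 - of_nat m" by auto
    then show "T x = R x"
    proof cases
      case 1
      have "of_nat m - of_nat n = - (of_nat (n - m) :: rat)" "n + 1 > n - m"
        using 1 by (auto simp: of_nat_diff)
      then have "pochhammer (of_nat m - of_nat n :: rat) (n + 1) = 0"
        by (simp only: pochhammer_of_nat_eq_0_lemma)
      then show ?thesis using 1 by (simp add: T_0 R_def)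
    next
      case 2
      then show ?thesis using R_neg[of m] by simp
    qed
  qed
  then show ?thesis
    unfolding T_nat[symmetric] by (simp only: R_def B_def C_def)
qed

subsection \<open>Closed forms at positive integers\<close>

lemma pochhammer_three_halves: "pochhammer (3 / 2 :: rat) k = fact (2 * k + 1) / (4 ^ k * fact k)"
proof -
  have "4 ^ (k + 1) * pochhammer (1 / 2) (k + 1) * fact (k + 1) = (fact (2 * (k + 1)) :: rat)"
    by (rule fact_double_four[symmetric])
  then have "(2 * of_nat k + 2) * (4 ^ k * pochhammer (3 / 2) k * fact k) = (2 * of_nat k + 2) * (fact (2 * k + 1) :: rat)"
    by (simp add: pochhammer_rec algebra_simps)
  moreover have "2 * of_nat k + 2 \<noteq> (0 :: rat)"
    using of_nat_0_le_iff[of k, where 'a = rat] by linarith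
  ultimately have "4 ^ k * pochhammer (3 / 2) k * fact k = (fact (2 * k + 1) :: rat)"
    by (metis mult_left_cancel)
  then show ?thesis by (simp add: field_simps del: fact_Suc)
qed

lemma pochhammer_three_halves_mult:
  "pochhammer (of_nat n + 3 / 2 :: rat) k = pochhammer (3 / 2) (n + k) / pochhammer (3 / 2) n"
  using pochhammer_product'[of "3 / 2 :: rat" n k] pochhammer_pos_rat_neq_0[of "3 / 2" n]
  by (simp add: add.commute)

text \<open>The part of the squared norm of the \<open>n\<close>-th monic polynomial that is free of
  \<open>r\<close>; the factorial products of the theorem come from it.\<close>

definition ortho_const :: "nat \<Rightarrow> rat" where
  "ortho_const n = 1 / 2 * fact n ^ 2 / (pochhammer (of_nat n + 3 / 2) n * pochhammer (of_nat n + 3 / 2) (n + 1))"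

lemma ortho_const_eq:
  "ortho_const n = 2 * 16 ^ n * fact (2 * n + 1) ^ 3 * fact (2 * n) / (fact (4 * n + 1) * fact (4 * n + 3))"
proof -
  have 1: "n + n = 2 * n" "n + (n + 1) = 2 * n + 1" "2 * (2 * n) + 1 = 4 * n + 1" "2 * (2 * n + 1) + 1 = 4 * n + 3"
    by simp_all
  have 2: "(4 :: rat) ^ (2 * n) = 16 ^ n" "(4 :: rat) ^ (2 * n + 1) = 4 * 16 ^ n" "(4 :: rat) ^ n * 4 ^ n = 16 ^ n"
    by (simp_all add: power_mult flip: power_mult_distrib)
  have 3: "G / ((A / X) * (B / X)) = G / (A * B) * X ^ 2" for G A B X :: rat
    by (simp add: power2_eq_square)
  have "ortho_const n = 1 / 2 * fact n ^ 2 / ((fact (4 * n + 1) / (16 ^ n * fact (2 * n))) *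
      (fact (4 * n + 3) / (4 * 16 ^ n * fact (2 * n + 1)))) * (fact (2 * n + 1) / (4 ^ n * fact n)) ^ 2"
    unfolding ortho_const_def pochhammer_three_halves_mult pochhammer_three_halves 1 2 by (rule 3)
  also have "\<dots> = 1 / 2 * (16 ^ n * fact (2 * n)) * (4 * 16 ^ n * fact (2 * n + 1)) * fact (2 * n + 1) ^ 2
      / (fact (4 * n + 1) * fact (4 * n + 3) * (4 ^ n * 4 ^ n))"
  proof -
    have gen: "F \<noteq> 0 \<Longrightarrow> 1 / 2 * F ^ 2 / ((c / (p * a)) * (d / (4 * p * b))) * (b / (q * F)) ^ 2 =
        1 / 2 * (p * a) * (4 * p * b) * b ^ 2 / (c * d * (q * q))" for F a b c d p q :: rat
      by (simp add: power2_eq_square)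
    show ?thesis by (rule gen) simp
  qed
  also have "\<dots> = 2 * 16 ^ n * fact (2 * n + 1) ^ 3 * fact (2 * n) / (fact (4 * n + 1) * fact (4 * n + 3))"
  proof -
    have gen: "p \<noteq> 0 \<Longrightarrow> 1 / 2 * (p * a) * (4 * p * b) * b ^ 2 / (c * d * p) = 2 * p * b ^ 3 * a / (c * d)"
      for a b c d p :: rat
      by (simp add: power2_eq_square power3_eq_cube)
    show ?thesis unfolding 2 by (rule gen) simp
  qed
  finally show ?thesis .
qed

lemma hdet_power_sum_ortho_const:
  "hdet N (\<lambda>k. power_sum r (2 * k + 2)) = (\<Prod>i<N. ortho_const i) *
    (\<Prod>i<N. pochhammer (of_nat r - of_nat i) (2 * i + 2) * pochhammer (of_nat r + 1 / 2 - of_nat i) (2 * i + 1))"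
  unfolding hdet_power_sum prod.distrib[symmetric] by (simp add: ortho_const_def mult_ac)

text \<open>Once the prefactor is written in factorials, consecutive quotients of both sides are
  compared. The exponent is \<open>-1\<close> for \<open>n = 0\<close> and \<open>n = 1\<close>,
  hence \<open>powi\<close>.\<close>

lemma prod_ortho_const_det_V:
  "2 * fact n ^ 2 / (4 ^ (2 * n + 1) * pochhammer (3 / 2) n * pochhammer (of_nat n + 3 / 2) n) * (\<Prod>i<n. ortho_const i) =
    2 powi (2 * int n ^ 2 - 2 * int n - 1) * (\<Prod>i = 1..n. fact (2 * i) ^ 4 / (fact (4 * i) * fact (4 * i + 1)))"
proof -
  have 1: "2 * fact n ^ 2 / (4 ^ (2 * n + 1) * pochhammer (3 / 2) n * pochhammer (of_nat n + 3 / 2) n) =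
      fact n ^ 2 * fact (2 * n) / (2 * (fact (4 * n + 1) :: rat))"
  proof -
    have "pochhammer (3 / 2) n * pochhammer (of_nat n + 3 / 2 :: rat) n = fact (4 * n + 1) / (4 ^ (2 * n) * fact (2 * n))"
    proof -
      have idx: "n + n = 2 * n" "2 * (2 * n) + 1 = 4 * n + 1" by simp_all
      have "pochhammer (3 / 2) n * pochhammer (of_nat n + 3 / 2 :: rat) n = pochhammer (3 / 2) (n + n)"
        unfolding pochhammer_product' by (simp only: add.commute)
      then show ?thesis unfolding idx pochhammer_three_halves[of "2 * n"] .
    qed
    then show ?thesis by (simp add: mult.assoc del: fact_Suc)
  qed
  have 2: "fact n ^ 2 * fact (2 * n) / (2 * fact (4 * n + 1)) * (\<Prod>i<n. ortho_const i) =
    2 powi (2 * int n ^ 2 - 2 * int n - 1) * (\<Prod>i = 1..n. fact (2 * i) ^ 4 / (fact (4 * i) * fact (4 * i + 1)))"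
  proof (induction n)
    case 0
    have "2 * int 0 ^ 2 - 2 * int 0 - 1 = -1" by simp
    moreover have "(2 :: rat) powi - 1 = 1 / 2"
      by (simp only: power_int_minus1_right inverse_eq_divide)
    ultimately show ?case by (simp only: mult_0_right add_0 fact_0) simp
  next
    case (Suc n)
    define a where "a = (fact (2 * n) :: rat)"
    define b where "b = (fact (4 * n + 1) :: rat)"
    define c where "c = (fact (4 * n + 3) :: rat)"
    define t where "t = (of_nat n + 1 :: rat)"
    define s where "s = (2 * of_nat n + 1 :: rat)"
    define w where "w = (4 * of_nat n + 5 :: rat)"
    define P where "P = (\<Prod>i = 1..n. fact (2 * i) ^ 4 / (fact (4 * i) * fact (4 * i + 1)) :: rat)"
    define Q where "Q = (\<Prod>i<n. ortho_const i)"
    define p where "p = (2 :: rat) powi (2 * int n ^ 2 - 2 * int n - 1)"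
    have nz: "c \<noteq> 0" "t \<noteq> 0" "w \<noteq> 0"
      using of_nat_0_le_iff[of n, where 'a = rat] unfolding c_def t_def w_def by (simp, linarith+)
    have f: "fact (Suc n) = t * fact n" "fact (2 * n + 1) = s * a" "fact (2 * Suc n) = 2 * t * (s * a)"
      "fact (4 * Suc n) = 4 * t * c" "fact (4 * Suc n + 1) = w * (4 * t * c)"
      by (simp_all add: t_def s_def w_def a_def c_def eval_nat_numeral algebra_simps)
    \<comment> \<open>The exponent grows by exactly \<open>4 * n\<close>, which matches the factor
      \<open>16 ^ n\<close> of \<open>ortho_const n\<close>.\<close>
    have "2 * int (Suc n) ^ 2 - 2 * int (Suc n) - 1 = (2 * int n ^ 2 - 2 * int n - 1) + int (4 * n)"
      by (simp add: power2_eq_square algebra_simps)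
    moreover have "2 powi ((2 * int n ^ 2 - 2 * int n - 1) + int (4 * n)) = p * 2 powi int (4 * n)"
      unfolding p_def by (rule power_int_add) simp
    moreover have "2 powi int (4 * n) = (16 ^ n :: rat)"
      by (simp only: power_int_of_nat power_mult) simp
    ultimately have p': "2 powi (2 * int (Suc n) ^ 2 - 2 * int (Suc n) - 1) = p * 16 ^ n"
      by (simp only:)
    have IH: "fact n ^ 2 * a / (2 * b) * Q = p * P"
      using Suc.IH unfolding a_def b_def P_def Q_def p_def .
    have oc: "ortho_const n = 2 * 16 ^ n * (s * a) ^ 3 * a / (b * c)"
      unfolding ortho_const_eq f by (simp only: a_def b_def c_def)
    have "fact (Suc n) ^ 2 * fact (2 * Suc n) / (2 * fact (4 * Suc n + 1)) * (\<Prod>i<Suc n. ortho_const i) =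
        (t * fact n) ^ 2 * (2 * t * (s * a)) / (2 * (w * (4 * t * c))) * (Q * (2 * 16 ^ n * (s * a) ^ 3 * a / (b * c)))"
      unfolding f prod.lessThan_Suc oc Q_def ..
    also have "\<dots> = (fact n ^ 2 * a / (2 * b) * Q) * (t ^ 2 * (2 * t * s) / (w * (4 * t * c)) * (2 * 16 ^ n * (s * a) ^ 3 * a / c))"
    proof -
      have "(t * F) ^ 2 * (2 * t * (s * a)) / (2 * (w * (4 * t * c))) * (Q * (2 * k * (s * a) ^ 3 * a / (b * c))) =
        (F ^ 2 * a / (2 * b) * Q) * (t ^ 2 * (2 * t * s) / (w * (4 * t * c)) * (2 * k * (s * a) ^ 3 * a / c))" for F k
        by (simp add: power2_eq_square)
      then show ?thesis .
    qed
    also have "t ^ 2 * (2 * t * s) / (w * (4 * t * c)) * (2 * 16 ^ n * (s * a) ^ 3 * a / c) =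
        16 ^ n * (2 * t * (s * a)) ^ 4 / (4 * t * c * (w * (4 * t * c)))"
    proof -
      have "t ^ 2 * (2 * t * s) / (w * (4 * t * c)) * (2 * k * (s * a) ^ 3 * a / c) =
        k * (2 * t * (s * a)) ^ 4 / (4 * t * c * (w * (4 * t * c)))" for k
        using nz by (simp add: power2_eq_square power3_eq_cube power4_eq_xxxx mult_ac)
      then show ?thesis .
    qed
    also have "fact n ^ 2 * a / (2 * b) * Q = p * P" by (rule IH)
    also have "p * P * (16 ^ n * (2 * t * (s * a)) ^ 4 / (4 * t * c * (w * (4 * t * c)))) =
        p * 16 ^ n * (P * (fact (2 * Suc n) ^ 4 / (fact (4 * Suc n) * fact (4 * Suc n + 1))))"
      unfolding f by (simp only: times_divide_eq_right mult_ac)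
    also have "P * (fact (2 * Suc n) ^ 4 / (fact (4 * Suc n) * fact (4 * Suc n + 1))) =
        (\<Prod>i = 1..Suc n. fact (2 * i) ^ 4 / (fact (4 * i) * fact (4 * i + 1)))"
      unfolding P_def by (rule prod.nat_ivl_Suc'[symmetric, THEN trans[OF mult.commute]]) simp
    finally show ?case unfolding p' .
  qed
  show ?thesis unfolding 1 by (rule 2)
qed

text \<open>The powers \<open>2^(4j+3)\<close> come from rescaling \<open>r\<close> to
  \<open>x = 2r+1\<close> in \<open>pochhammer_double_odd\<close>; the factor \<open>1/4\<close>
  offsets \<open>x^2 - (2i-1)^2 = 4 (r-m)(r+m+1)\<close> with \<open>i = m+1\<close>.\<close>

lemma prod_ortho_const_hankel_4:
  "1 / 2 * fact (n + 1) ^ 2 * pochhammer (3 / 2) (n + 1) / pochhammer (of_nat n + 5 / 2) (n + 1) * (\<Prod>i<n + 1. ortho_const i) =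
    1 / 4 * (1 / (5 * 2 ^ (n + 2)) * (\<Prod>i = 1..n. (fact (2 * i + 3) ^ 2 * fact (2 * i + 2) ^ 2)
              / (fact (4 * i + 5) * fact (4 * i + 4))) * (\<Prod>j\<le>n. 2 ^ (4 * j + 3)))"
proof -
  have "1 / 2 * fact (n + 1) ^ 2 * pochhammer (3 / 2) (n + 1) / pochhammer (of_nat n + 5 / 2) (n + 1) =
      1 / 2 * fact (2 * n + 3) ^ 2 * fact (2 * n + 2) / (fact (4 * n + 5) :: rat)"
  proof -
    have 1: "n + 1 + (n + 1) = 2 * n + 2" "2 * (n + 1) + 1 = 2 * n + 3" "2 * (2 * n + 2) + 1 = 4 * n + 5" by simp_all
    have 2: "(4 :: rat) ^ (2 * n + 2) = 4 ^ (n + 1) * 4 ^ (n + 1)" by (simp flip: power_add add: mult_2)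
    have "of_nat n + 5 / 2 = (of_nat (n + 1) + 3 / 2 :: rat)" by simp
    then have "pochhammer (of_nat n + 5 / 2 :: rat) (n + 1) =
        (fact (4 * n + 5) / (4 ^ (n + 1) * 4 ^ (n + 1) * fact (2 * n + 2))) / (fact (2 * n + 3) / (4 ^ (n + 1) * fact (n + 1)))"
      by (simp only: pochhammer_three_halves_mult pochhammer_three_halves 1 2)
    moreover have "pochhammer (3 / 2 :: rat) (n + 1) = fact (2 * n + 3) / (4 ^ (n + 1) * fact (n + 1))"
      by (simp only: pochhammer_three_halves 1)
    ultimately show ?thesis
      by (simp add: power2_eq_square mult_ac del: fact_Suc power_Suc)
  qed
  moreover have "1 / 2 * fact (2 * n + 3) ^ 2 * fact (2 * n + 2) / fact (4 * n + 5) * (\<Prod>i<n + 1. ortho_const i) =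
    1 / 4 * (1 / (5 * 2 ^ (n + 2)) * (\<Prod>i = 1..n. (fact (2 * i + 3) ^ 2 * fact (2 * i + 2) ^ 2)
              / (fact (4 * i + 5) * fact (4 * i + 4))) * (\<Prod>j\<le>n. 2 ^ (4 * j + 3)))"
  proof (induction n)
    case 0
    then show ?case by (simp add: ortho_const_eq fact_numeral)
  next
    case (Suc n)
    define h where "h = (2 * of_nat n + 4 :: rat)"
    have h: "h \<noteq> 0" using of_nat_0_le_iff[of n, where 'a = rat] unfolding h_def by linarith
    define a where "a = (fact (2 * n + 3) :: rat)"
    define b where "b = (fact (2 * n + 2) :: rat)"
    define c where "c = (fact (4 * n + 5) :: rat)"
    define d where "d = (fact (4 * n + 7) :: rat)"
    define e where "e = (fact (2 * n + 5) :: rat)"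
    define g where "g = (fact (4 * n + 9) :: rat)"
    define P where "P = (\<Prod>i = 1..n. (fact (2 * i + 3) ^ 2 * fact (2 * i + 2) ^ 2)
              / (fact (4 * i + 5) * fact (4 * i + 4)) :: rat)"
    define R where "R = (\<Prod>j\<le>n. 2 ^ (4 * j + 3) :: rat)"
    define Q where "Q = (\<Prod>i<n + 1. ortho_const i)"
    have nz: "a \<noteq> 0" "b \<noteq> 0" "c \<noteq> 0" "d \<noteq> 0" "e \<noteq> 0" "g \<noteq> 0" by (simp_all add: a_def b_def c_def d_def e_def g_def)
    have idx: "2 * Suc n + 3 = 2 * n + 5" "4 * Suc n + 5 = 4 * n + 9" "2 * Suc n + 1 = 2 * n + 3" "2 * Suc n = 2 * n + 2"
      "4 * Suc n + 1 = 4 * n + 5" "4 * Suc n + 3 = 4 * n + 7" "2 * n + 2 + 3 = 2 * n + 5" by simp_all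
    have f: "fact (2 * n + 2 + 2) = h * a" "fact (4 * Suc n + 4) = 2 * h * d"
      by (simp_all add: h_def a_def b_def c_def d_def eval_nat_numeral algebra_simps)
    have IH: "1 / 2 * a ^ 2 * b / c * Q = 1 / 4 * (1 / (5 * 2 ^ (n + 2)) * P * R)"
      using Suc.IH unfolding a_def b_def c_def P_def Q_def R_def .
    have "1 / 2 * fact (2 * Suc n + 3) ^ 2 * fact (2 * Suc n + 2) / fact (4 * Suc n + 5) * (\<Prod>i<Suc n + 1. ortho_const i) =
        1 / 2 * e ^ 2 * (h * a) / g * (Q * (2 * 16 ^ Suc n * a ^ 3 * b / (c * d)))"
    proof -
      have "2 * (n + 1) + 1 = 2 * n + 3" "2 * (n + 1) = 2 * n + 2" "4 * (n + 1) + 1 = 4 * n + 5"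
        "4 * (n + 1) + 3 = 4 * n + 7" "n + 1 = Suc n" by simp_all
      then have oc: "ortho_const (n + 1) = 2 * 16 ^ Suc n * a ^ 3 * b / (c * d)"
        by (simp only: ortho_const_eq a_def b_def c_def d_def)
      have "(\<Prod>i<Suc n + 1. ortho_const i) = Q * ortho_const (n + 1)"
        by (simp add: Q_def)
      then show ?thesis unfolding idx f oc by (simp only: e_def g_def)
    qed
    also have "\<dots> = (1 / 2 * a ^ 2 * b / c * Q) * (e ^ 2 * (h * a) / g * (2 * 16 ^ Suc n * a / d))"
      by (simp add: power2_eq_square power3_eq_cube)
    also have "\<dots> = 1 / 4 * (1 / (5 * 2 ^ (Suc n + 2)) * (P * (e ^ 2 * (h * a) ^ 2 / (g * (2 * h * d)))) * (R * (8 * 16 ^ Suc n)))"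
    proof -
      have "e ^ 2 * (h * a) / g * (2 * 16 ^ Suc n * a / d) =
          1 / 2 * (e ^ 2 * (h * a) ^ 2 / (g * (2 * h * d))) * (8 * 16 ^ Suc n)"
        using nz h by (simp add: power2_eq_square mult_ac del: power_Suc)
      then show ?thesis unfolding IH by (simp add: mult_ac)
    qed
    also have "(8 :: rat) * 16 ^ Suc n = 2 ^ (4 * Suc n + 3)"
      by (simp add: power_add power_mult)
    also have "e ^ 2 * (h * a) ^ 2 / (g * (2 * h * d)) =
        (fact (2 * Suc n + 3) ^ 2 * fact (2 * Suc n + 2) ^ 2) / (fact (4 * Suc n + 5) * fact (4 * Suc n + 4))"
      unfolding idx f by (simp only: e_def g_def)
    also have "P * \<dots> = (\<Prod>i = 1..Suc n. (fact (2 * i + 3) ^ 2 * fact (2 * i + 2) ^ 2)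
              / (fact (4 * i + 5) * fact (4 * i + 4)))"
      unfolding P_def by (rule prod.nat_ivl_Suc'[symmetric, THEN trans[OF mult.commute]]) simp
    finally show ?case
      unfolding R_def prod.atMost_Suc .
  qed
  ultimately show ?thesis by (simp only:)
qed

text \<open>The factors \<open>x, x-1, ..., x-n\<close> of the first symbol are dealt out, each as
  the lowest factor of one \<open>(x-l)_(2l+1)\<close>.\<close>

lemma prod_pochhammer_det_V:
  fixes x :: "'a :: comm_ring_1"
  shows "pochhammer (x - of_nat n) (n + 1) * (\<Prod>i<n. pochhammer (x - of_nat i) (2 * i + 2)) =
    (\<Prod>l = 0..n. pochhammer (x - of_nat l) (2 * l + 1))"
proof (induction n)
  case (Suc n)
  have "pochhammer (x - of_nat (Suc n)) (Suc n + 1) = (x - of_nat (Suc n)) * pochhammer (x - of_nat n) (n + 1)"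
    using pochhammer_rec[of "x - of_nat (Suc n)" "n + 1"] by (simp add: algebra_simps)
  moreover have "pochhammer (x - of_nat (Suc n)) (2 * Suc n + 1) = (x - of_nat (Suc n)) * pochhammer (x - of_nat n) (2 * n + 2)"
    using pochhammer_rec[of "x - of_nat (Suc n)" "2 * n + 2"] by (simp add: algebra_simps)
  ultimately show ?case using Suc.IH by (simp add: mult_ac del: of_nat_Suc)
qed simp

text \<open>The duplication formula covers the even length \<open>4j+2\<close>; the last factor is
  \<open>2 (z+2j+1)\<close> and lengthens the first of the two symbols.\<close>

lemma pochhammer_double_odd:
  fixes z :: "'a :: field_char_0"
  shows "pochhammer (2 * z) (4 * j + 3) = 2 ^ (4 * j + 3) * (pochhammer z (2 * j + 2) * pochhammer (z + 1 / 2) (2 * j + 1))"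
proof -
  have "pochhammer (2 * z) (4 * j + 3) = pochhammer (2 * z) (2 * (2 * j + 1)) * (2 * z + of_nat (4 * j + 2))"
  proof -
    have "4 * j + 3 = Suc (4 * j + 2)" "2 * (2 * j + 1) = 4 * j + 2" by simp_all
    then show ?thesis by (simp only: pochhammer_Suc)
  qed
  also have "\<dots> = 2 ^ (4 * j + 3) * ((pochhammer z (2 * j + 1) * (z + of_nat (2 * j + 1))) * pochhammer (z + 1 / 2) (2 * j + 1))"
    unfolding pochhammer_double by (simp add: algebra_simps power_add power_mult)
  also have "pochhammer z (2 * j + 1) * (z + of_nat (2 * j + 1)) = pochhammer z (2 * j + 2)"
    using pochhammer_Suc[of z "2 * j + 1"] by simp
  finally show ?thesis .
qed

lemma prod_pochhammer_hankel_4: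
  fixes x r :: "'a :: field_char_0"
  assumes "x = 2 * r + 1"
  shows "(\<Prod>l = 0..n. pochhammer (x - 2 * of_nat n - 1 + 2 * of_nat l) (4 * n - 4 * l + 3)) =
    (\<Prod>j\<le>n. 2 ^ (4 * j + 3)) *
    (\<Prod>j<n + 1. pochhammer (r - of_nat j) (2 * j + 2) * pochhammer (r + 1 / 2 - of_nat j) (2 * j + 1))"
proof -
  have "(\<Prod>l = 0..n. pochhammer (x - 2 * of_nat n - 1 + 2 * of_nat l) (4 * n - 4 * l + 3)) =
      (\<Prod>j\<le>n. pochhammer (2 * (r - of_nat j)) (4 * j + 3))"
    by (rule prod.reindex_bij_witness[of _ "\<lambda>j. n - j" "\<lambda>l. n - l"])
      (auto simp: assms of_nat_diff algebra_simps diff_mult_distrib2)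
  then show ?thesis
    unfolding pochhammer_double_odd prod.distrib by (simp add: lessThan_Suc_atMost algebra_simps)
qed

lemma pochhammer_Suc_prod_atMost: "pochhammer a (n + 1) = (\<Prod>j\<le>n. a + of_nat j)"
  for a :: "'a :: comm_semiring_1"
  by (simp add: pochhammer_Suc_prod atLeast0AtMost)

lemma det_V_mat_closed_form:
  "det (V_mat r n) =
    2 powi (2 * int n ^ 2 - 2 * int n - 1)
    * (\<Prod>i = 1..n. fact (2 * i) ^ 4 / (fact (4 * i) * fact (4 * i + 1)))
    * (\<Prod>l = 0..n. pochhammer (of_nat r - of_nat l) (2 * l + 1))
    * (\<Prod>l\<in>{0..<n}. pochhammer (of_nat r + 1 / 2 - of_nat l) (2 * l + 1))
    * (\<Sum>i = 1..n + 1.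
        (fact (2 * n + 2 * i) * fact (2 * n + 2 - 2 * i) * pochhammer (of_nat r + 1) (n + 1))
        / (fact (n + i) ^ 2 * fact (n + 1 - i) ^ 2 * (of_nat r + of_nat i)))"
proof -
  define S where "S = (\<Sum>m\<le>n. fact (2 * n + 2 * m + 2) * fact (2 * n - 2 * m) / (fact (n + m + 1) ^ 2 * fact (n - m) ^ 2)
      * (\<Prod>j\<in>{..n} - {m}. of_nat r + of_nat j + 1 :: rat))"
  define T where "T = (\<Sum>i = 1..n + 1.
        (fact (2 * n + 2 * i) * fact (2 * n + 2 - 2 * i) * pochhammer (of_nat r + 1) (n + 1))
        / (fact (n + i) ^ 2 * fact (n + 1 - i) ^ 2 * (of_nat r + of_nat i) :: rat))"
  have ST: "S = T"
    unfolding S_def T_def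
  proof (rule sum.reindex_bij_witness[of _ "\<lambda>i. i - 1" "\<lambda>m. m + 1"])
    fix m assume "m \<in> {..n}"
    then have m: "m \<le> n" by simp
    have "pochhammer (of_nat r + 1 :: rat) (n + 1) =
        (of_nat r + of_nat (m + 1)) * (\<Prod>j\<in>{..n} - {m}. of_nat r + of_nat j + 1)"
      unfolding pochhammer_Suc_prod_atMost using m
      by (subst prod.remove[of _ m]) (auto simp: add_ac)
    moreover have "of_nat r + of_nat (m + 1) \<noteq> (0 :: rat)"
      by (metis add_is_0 of_nat_add of_nat_eq_0_iff zero_neq_one)
    ultimately show "(fact (2 * n + 2 * (m + 1)) * fact (2 * n + 2 - 2 * (m + 1)) * pochhammer (of_nat r + 1) (n + 1))
        / (fact (n + (m + 1)) ^ 2 * fact (n + 1 - (m + 1)) ^ 2 * (of_nat r + of_nat (m + 1)) :: rat) =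
      fact (2 * n + 2 * m + 2) * fact (2 * n - 2 * m) / (fact (n + m + 1) ^ 2 * fact (n - m) ^ 2)
      * (\<Prod>j\<in>{..n} - {m}. of_nat r + of_nat j + 1 :: rat)"
      by (simp add: add_ac del: fact_Suc of_nat_add of_nat_Suc)
  qed auto
  define A where "A = (\<Prod>i<n. pochhammer (of_nat r - of_nat i :: rat) (2 * i + 2))"
  define B where "B = (\<Prod>i<n. pochhammer (of_nat r + 1 / 2 - of_nat i :: rat) (2 * i + 1))"
  define Q where "Q = (\<Prod>i<n. ortho_const i)"
  define P where "P = pochhammer (of_nat n + 3 / 2 :: rat) n"
  define P' where "P' = pochhammer (3 / 2 :: rat) n"
  define W where "W = pochhammer (of_nat r - of_nat n :: rat) (n + 1)"
  have nz: "P \<noteq> 0" unfolding P_def by (rule pochhammer_pos_rat_neq_0) simp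
  have "P * det (V_mat r n) = (-1) ^ n * ((-1) ^ n * 2 * fact n ^ 2 / (4 ^ (2 * n + 1) * P') * W * S) * (Q * (A * B))"
    unfolding P_def det_V_mat sum_ortho_poly_squares hdet_power_sum_ortho_const prod.distrib
    by (simp only: P'_def W_def S_def Q_def A_def B_def)
  also have "\<dots> = ((-1) ^ n * (-1) ^ n) * (2 * fact n ^ 2 / (4 ^ (2 * n + 1) * P') * W * S * (Q * (A * B)))"
    by (simp add: mult_ac)
  also have "\<dots> = P * ((2 * fact n ^ 2 / (4 ^ (2 * n + 1) * P' * P) * Q) * (W * A) * B * S)"
    using nz by (simp flip: power_mult_distrib)
  finally have "det (V_mat r n) = (2 * fact n ^ 2 / (4 ^ (2 * n + 1) * P' * P) * Q) * (W * A) * B * S"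
    using nz mult_left_cancel by blast
  then show ?thesis
    unfolding P_def P'_def W_def A_def Q_def prod_ortho_const_det_V prod_pochhammer_det_V ST
    by (simp only: B_def T_def atLeast0LessThan)
qed

text \<open>The bound on \<open>r\<close> keeps \<open>x^2 - (2i-1)^2 = 4 (r+1-i)(r+i)\<close> away
  from 0 for all \<open>i \<le> n+2\<close>, so that each summand is a genuine quotient.\<close>

lemma hankel_det_power_sum_4_closed_form:
  fixes x :: rat
  assumes "r > n + 1" and x: "x = 2 * of_nat r + 1"
  shows "hankel_det n (\<lambda>k. power_sum r (2 * k + 4)) =
    1 / (5 * 2 ^ (n + 2))
    * (\<Prod>i = 1..n. (fact (2 * i + 3) ^ 2 * fact (2 * i + 2) ^ 2) / (fact (4 * i + 5) * fact (4 * i + 4)))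
    * (\<Prod>l = 0..n. pochhammer (x - 2 * of_nat n - 1 + 2 * of_nat l) (4 * n - 4 * l + 3))
    * (\<Sum>i = 1..n + 2.
        ((2 * of_nat i - 1) * pochhammer (of_nat n + 5 / 2) (i - 1)
          * pochhammer (x / 2 + 1 / 2) (n + 2) * pochhammer (x / 2 - of_nat n - 3 / 2) (n + 2))
        / (pochhammer (of_nat n - of_nat i + 5 / 2) i * fact (n + 2 - i) * fact (n + 1 + i)
          * (x ^ 2 - (2 * of_nat i - 1) ^ 2)))"
proof -
  define S where "S = (\<Sum>m\<le>n + 1. of_nat (2 * m + 1) * pochhammer (of_nat (n + 1) + 3 / 2) m
      / (pochhammer (of_nat (n + 1) - of_nat m + 1 / 2) (m + 1) * fact (n + 1 - m) * fact (n + 1 + m + 1))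
      * (\<Prod>j\<in>{..n + 1} - {m}. (of_nat r - of_nat j) * (of_nat r + of_nat j + 1)) :: rat)"
  define T where "T = (\<Sum>i = 1..n + 2.
        ((2 * of_nat i - 1) * pochhammer (of_nat n + 5 / 2) (i - 1)
          * pochhammer (x / 2 + 1 / 2) (n + 2) * pochhammer (x / 2 - of_nat n - 3 / 2) (n + 2))
        / (pochhammer (of_nat n - of_nat i + 5 / 2) i * fact (n + 2 - i) * fact (n + 1 + i)
          * (x ^ 2 - (2 * of_nat i - 1) ^ 2)))"
  have "1 / 4 * S = T"
    unfolding S_def T_def sum_distrib_left
  proof (rule sum.reindex_bij_witness[of _ "\<lambda>i. i - 1" "\<lambda>m. m + 1"])
    fix m assume "m \<in> {..n + 1}"
    then have m: "m \<le> n + 1" by simp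
    define D where "D = (\<Prod>j\<in>{..n + 1} - {m}. (of_nat r - of_nat j) * (of_nat r + of_nat j + 1) :: rat)"
    define u where "u = (of_nat r - of_nat m) * (of_nat r + of_nat m + 1 :: rat)"
    have "(of_nat m :: rat) < of_nat r" using m assms(1) by simp
    moreover have "(of_nat r + of_nat m + 1 :: rat) > 0" by (simp add: add_nonneg_pos)
    ultimately have u: "u \<noteq> 0" by (simp add: u_def)
    have "x / 2 + 1 / 2 = of_nat r + 1" by (simp add: x add_divide_distrib)
    then have p1: "pochhammer (x / 2 + 1 / 2) (n + 2) = (\<Prod>j\<le>n + 1. of_nat r + of_nat j + 1)"
      using pochhammer_Suc_prod_atMost[of "of_nat r + 1 :: rat" "n + 1"] by (simp add: add_ac)
    have "x / 2 - of_nat n - 3 / 2 = of_nat r - of_nat (n + 1)" by (simp add: x add_divide_distrib)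
    then have p2: "pochhammer (x / 2 - of_nat n - 3 / 2) (n + 2) = (\<Prod>j\<le>n + 1. of_nat r - of_nat j)"
      unfolding pochhammer_Suc_prod_atMost[of "of_nat r - of_nat (n + 1) :: rat" "n + 1", simplified]
      using pochhammer_Suc_prod_atMost[of "of_nat r - of_nat (n + 1) :: rat" "n + 1"]
      by (simp only: add.assoc one_add_one)
        (rule prod.reindex_bij_witness[of _ "\<lambda>j. n + 1 - j" "\<lambda>l. n + 1 - l"], auto simp: of_nat_diff)
    have "pochhammer (x / 2 + 1 / 2) (n + 2) * pochhammer (x / 2 - of_nat n - 3 / 2) (n + 2) =
        (\<Prod>j\<le>n + 1. (of_nat r - of_nat j) * (of_nat r + of_nat j + 1))"
      unfolding p1 p2 prod.distrib by (rule mult.commute)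
    also have "\<dots> = u * D"
      unfolding u_def D_def using m by (subst prod.remove[of _ m]) auto
    finally have pp: "pochhammer (x / 2 + 1 / 2) (n + 2) * pochhammer (x / 2 - of_nat n - 3 / 2) (n + 2) = u * D" .
    have xx: "x ^ 2 - (2 * of_nat (m + 1) - 1) ^ 2 = 4 * u"
      by (simp add: x u_def power2_eq_square algebra_simps)
    have idx: "m + 1 - 1 = m" "n + 2 - (m + 1) = n + 1 - m" "n + 1 + (m + 1) = n + 1 + m + 1" by simp_all
    have par: "of_nat n + 5 / 2 = (of_nat (n + 1) + 3 / 2 :: rat)"
      "of_nat n - of_nat (m + 1) + 5 / 2 = (of_nat (n + 1) - of_nat m + 1 / 2 :: rat)"
      "2 * of_nat (m + 1) - 1 = (of_nat (2 * m + 1) :: rat)" by simp_all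
    show "((2 * of_nat (m + 1) - 1) * pochhammer (of_nat n + 5 / 2) (m + 1 - 1)
          * pochhammer (x / 2 + 1 / 2) (n + 2) * pochhammer (x / 2 - of_nat n - 3 / 2) (n + 2))
        / (pochhammer (of_nat n - of_nat (m + 1) + 5 / 2) (m + 1) * fact (n + 2 - (m + 1)) * fact (n + 1 + (m + 1))
          * (x ^ 2 - (2 * of_nat (m + 1) - 1) ^ 2)) =
      1 / 4 * (of_nat (2 * m + 1) * pochhammer (of_nat (n + 1) + 3 / 2) m
      / (pochhammer (of_nat (n + 1) - of_nat m + 1 / 2) (m + 1) * fact (n + 1 - m) * fact (n + 1 + m + 1))
      * (\<Prod>j\<in>{..n + 1} - {m}. (of_nat r - of_nat j) * (of_nat r + of_nat j + 1)))"
      unfolding mult.assoc[of _ "pochhammer (x / 2 + 1 / 2) (n + 2)"] pp xx idx D_def[symmetric]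
      unfolding par using u by (simp add: mult_ac del: fact_Suc of_nat_Suc of_nat_add of_nat_mult)
  qed auto
  then have ST: "S = 4 * T" by simp
  define A where "A = (\<Prod>i<n + 1. pochhammer (of_nat r - of_nat i) (2 * i + 2) * pochhammer (of_nat r + 1 / 2 - of_nat i :: rat) (2 * i + 1))"
  define Q where "Q = (\<Prod>i<n + 1. ortho_const i)"
  define P where "P = pochhammer (of_nat n + 5 / 2 :: rat) (n + 1)"
  define P' where "P' = pochhammer (3 / 2 :: rat) (n + 1)"
  define H where "H = hankel_det n (\<lambda>k. power_sum r (2 * k + 4))"
  have nz: "P \<noteq> 0" unfolding P_def by (rule pochhammer_pos_rat_neq_0) simp
  have "P * H = (-1) ^ (n + 1) * ((-1) ^ (n + 1) / 2 * fact (n + 1) ^ 2 * P' * S) * (Q * A)"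
    unfolding P_def H_def hankel_det_power_sum_4 ortho_poly_0 hdet_power_sum_ortho_const
    by (simp only: P'_def S_def Q_def A_def)
  also have "\<dots> = ((-1) ^ (n + 1) * (-1) ^ (n + 1)) * (1 / 2 * fact (n + 1) ^ 2 * P' * (4 * T) * (Q * A))"
    unfolding ST by (simp add: mult_ac)
  also have "\<dots> = P * ((1 / 2 * fact (n + 1) ^ 2 * P' / P * Q) * (4 * T) * A)"
    using nz by (simp flip: power_mult_distrib)
  finally have "H = (1 / 2 * fact (n + 1) ^ 2 * P' / P * Q) * (4 * T) * A"
    using nz mult_left_cancel by blast
  moreover have "1 / 4 * (a * b * c) * (4 * t) * d = a * b * (c * d) * t" for a b c d t :: rat
    by simp
  ultimately show ?thesis
    unfolding P_def P'_def Q_def prod_ortho_const_hankel_4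
    by (simp only: A_def T_def H_def prod_pochhammer_hankel_4[OF x])
qed

subsection \<open>Evaluation of rational functions\<close>

text \<open>A relation, because evaluation at \<open>a\<close> is partial: some representation must
  have a denominator that does not vanish at \<open>a\<close>. The closure rules follow the syntax
  of a term, so whole formulas are evaluated by introduction rules.\<close>

definition fract_value :: "rat \<Rightarrow> rat poly fract \<Rightarrow> rat \<Rightarrow> bool" where
  "fract_value a f v \<longleftrightarrow>
    (\<exists>p q. poly q a \<noteq> 0 \<and> f = to_fract p / to_fract q \<and> v = poly p a / poly q a)"

lemma fract_value_to_fract: "fract_value a (to_fract p) (poly p a)"
  unfolding fract_value_def by (rule exI[of _ p], rule exI[of _ 1]) simp

lemma fract_value_X: "fract_value a ratfun_X a"
  using fract_value_to_fract[of a "[:0, 1:]"] by (simp add: ratfun_X_def)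

lemma to_fract_of_nat: "to_fract (of_nat n) = of_nat n"
  by (induction n) simp_all

lemma fract_value_of_nat: "fract_value a (of_nat n) (of_nat n)"
  using fract_value_to_fract[of a "of_nat n"] by (simp add: to_fract_of_nat)

lemma fract_value_0: "fract_value a 0 0"
  and fract_value_1: "fract_value a 1 1"
  and fract_value_numeral: "fract_value a (numeral w) (numeral w)"
  using fract_value_of_nat[of a 0] fract_value_of_nat[of a 1] fract_value_of_nat[of a "numeral w"]
  by simp_all

lemma fract_value_fact: "fract_value a (fact n) (fact n)"
  using fract_value_of_nat[of a "fact n"] by simp

lemma fract_value_add:
  assumes "fract_value a f v" "fract_value a g w"
  shows "fract_value a (f + g) (v + w)"
proof -
  obtain p q p' q' where *: "poly q a \<noteq> 0" "f = to_fract p / to_fract q" "v = poly p a / poly q a"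
    "poly q' a \<noteq> 0" "g = to_fract p' / to_fract q'" "w = poly p' a / poly q' a"
    using assms unfolding fract_value_def by blast
  moreover have "q \<noteq> 0" "q' \<noteq> 0" using *(1,4) by auto
  ultimately show ?thesis
    unfolding fract_value_def
    by (intro exI[of _ "p * q' + p' * q"] exI[of _ "q * q'"]) (simp add: add_frac_eq)
qed

lemma fract_value_mult:
  assumes "fract_value a f v" "fract_value a g w"
  shows "fract_value a (f * g) (v * w)"
proof -
  obtain p q p' q' where *: "poly q a \<noteq> 0" "f = to_fract p / to_fract q" "v = poly p a / poly q a"
    "poly q' a \<noteq> 0" "g = to_fract p' / to_fract q'" "w = poly p' a / poly q' a"
    using assms unfolding fract_value_def by blast
  then show ?thesis
    unfolding fract_value_def by (intro exI[of _ "p * p'"] exI[of _ "q * q'"]) simp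
qed

lemma fract_value_uminus:
  assumes "fract_value a f v"
  shows "fract_value a (- f) (- v)"
proof -
  have "fract_value a (- 1) (- 1)"
    using fract_value_to_fract[of a "- 1"] by simp
  from fract_value_mult[OF this assms] show ?thesis by simp
qed

lemma fract_value_diff: "fract_value a f v \<Longrightarrow> fract_value a g w \<Longrightarrow> fract_value a (f - g) (v - w)"
  using fract_value_add[of a f v "- g" "- w"] fract_value_uminus[of a g w] by simp

lemma fract_value_divide:
  assumes "fract_value a f v" "fract_value a g w" "w \<noteq> 0"
  shows "fract_value a (f / g) (v / w)"
proof -
  obtain p q where "poly q a \<noteq> 0" "g = to_fract p / to_fract q" "w = poly p a / poly q a"
    using assms(2) unfolding fract_value_def by blast
  then have "fract_value a (inverse g) (inverse w)"
    using assms(3) unfolding fract_value_def by (intro exI[of _ q] exI[of _ p]) simp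
  from fract_value_mult[OF assms(1) this] show ?thesis by (simp add: divide_inverse)
qed

lemma fract_value_power: "fract_value a f v \<Longrightarrow> fract_value a (f ^ n) (v ^ n)"
  by (induction n) (auto intro: fract_value_1 fract_value_mult)

lemma fract_value_sum:
  "(\<And>i. i \<in> A \<Longrightarrow> fract_value a (f i) (v i)) \<Longrightarrow> fract_value a (\<Sum>i\<in>A. f i) (\<Sum>i\<in>A. v i)"
  by (induction A rule: infinite_finite_induct) (auto intro: fract_value_0 fract_value_add)

lemma fract_value_prod:
  "(\<And>i. i \<in> A \<Longrightarrow> fract_value a (f i) (v i)) \<Longrightarrow> fract_value a (\<Prod>i\<in>A. f i) (\<Prod>i\<in>A. v i)"
  by (induction A rule: infinite_finite_induct) (auto intro: fract_value_1 fract_value_mult)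

lemma fract_value_pochhammer:
  "fract_value a f v \<Longrightarrow> fract_value a (pochhammer f n) (pochhammer v n)"
  unfolding pochhammer_prod by (intro fract_value_prod fract_value_add fract_value_of_nat)

lemma fract_value_hankel_det:
  assumes "\<And>k. fract_value a (f k) (v k)"
  shows "fract_value a (hankel_det n f) (hankel_det n v)"
proof -
  have det: "hankel_det n c = (\<Sum>p | p permutes {0..<n + 1}. signof p * (\<Prod>i = 0..<n + 1. c (i + p i)))"
    for c :: "nat \<Rightarrow> 'b :: comm_ring_1"
  proof -
    have "hankel_det n c = (\<Sum>p | p permutes {0..<n + 1}. signof p *
        (\<Prod>i = 0..<n + 1. mat (n + 1) (n + 1) (\<lambda>(i, j). c (i + j)) $$ (i, p i)))"
      unfolding hankel_det_def by (rule det_def') simp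
    also have "\<dots> = (\<Sum>p | p permutes {0..<n + 1}. signof p * (\<Prod>i = 0..<n + 1. c (i + p i)))"
      by (intro sum.cong refl arg_cong2[of _ _ _ _ "(*)"] prod.cong) (auto dest: permutes_in_image)
    finally show ?thesis .
  qed
  have "fract_value a (signof p) (signof p)" for p :: "nat \<Rightarrow> nat"
    using fract_value_1 fract_value_uminus[OF fract_value_1] by (cases p rule: sign_cases) auto
  then show ?thesis
    unfolding det by (intro fract_value_sum fract_value_mult fract_value_prod assms)
qed

text \<open>The recursion replaces the quotient of power series in the definition by finitely many
  field operations with constant nonzero denominators.\<close>

lemma fract_value_bernpoly:
  assumes "fract_value a f v"
  shows "fract_value a (bernpoly n f) (bernpoly n v)"
proof (induction n rule: less_induct)
  case (less n)
  show ?case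
    by (subst (1 2) bernpoly_rec)
      (intro fract_value_diff fract_value_power fract_value_mult fract_value_sum fract_value_divide
        fract_value_fact assms less.IH; simp)
qed

text \<open>Cross-multiplying \<open>f - g = p/q\<close> with a representation defined at
  \<open>a\<close> shows that \<open>p\<close> vanishes at \<open>a\<close> even where
  \<open>q\<close> does. Infinitely many roots force \<open>p = 0\<close>.\<close>

lemma fract_eqI:
  assumes "infinite A" and "\<And>a. a \<in> A \<Longrightarrow> \<exists>v. fract_value a f v \<and> fract_value a g v"
  shows "f = g"
proof -
  obtain p q where pq: "f - g = Fract p q" "q \<noteq> 0" by (cases "f - g") auto
  have "poly p a = 0" if a: "a \<in> A" for a
  proof -
    obtain v where "fract_value a f v" "fract_value a g v" using assms(2)[OF a] by blast
    then have "fract_value a (f - g) 0" using fract_value_diff by fastforce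
    then obtain p' q' where *: "poly q' a \<noteq> 0" "f - g = to_fract p' / to_fract q'" "0 = poly p' a / poly q' a"
      unfolding fract_value_def by blast
    moreover have "q' \<noteq> 0" using *(1) by auto
    ultimately have "to_fract p * to_fract q' = to_fract p' * to_fract q"
      using pq by (simp add: Fract_conv_to_fract frac_eq_eq)
    then have "p * q' = p' * q" by (simp flip: to_fract_mult)
    then have "poly p a * poly q' a = poly p' a * poly q a" by (metis poly_mult)
    then show ?thesis using * by simp
  qed
  then have "A \<subseteq> {a. poly p a = 0}" by blast
  with assms(1) have "infinite {a. poly p a = 0}" using infinite_super by blast
  then have "p = 0" using poly_roots_finite by blast
  then show ?thesis using pq by (simp add: Fract_conv_to_fract)
qed

theorem theorem1p3:
  shows "(\<forall>n :: nat. let x = ratfun_X in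
      hankel_det n (\<lambda>k. bernpoly (2 * k + 5) ((x + 1) / 2) / of_nat (2 * k + 5)) =
        1 / (5 * 2 ^ (n + 2))
        * (\<Prod>i = 1..n. (fact (2 * i + 3) ^ 2 * fact (2 * i + 2) ^ 2)
              / (fact (4 * i + 5) * fact (4 * i + 4)))
        * (\<Prod>l = 0..n. pochhammer (x - 2 * of_nat n - 1 + 2 * of_nat l) (4 * n - 4 * l + 3))
        * (\<Sum>i = 1..n + 2.
            ((2 * of_nat i - 1) * pochhammer (of_nat n + 5 / 2) (i - 1)
              * pochhammer (x / 2 + 1 / 2) (n + 2)
              * pochhammer (x / 2 - of_nat n - 3 / 2) (n + 2))
            / (pochhammer (of_nat n - of_nat i + 5 / 2) i * fact (n + 2 - i) * fact (n + 1 + i)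
              * (x ^ 2 - (2 * of_nat i - 1) ^ 2))))
    \<and> (\<forall>n r :: nat. r \<ge> 1 \<longrightarrow>
      det (V_mat r n) =
        2 powi (2 * int n ^ 2 - 2 * int n - 1)
        * (\<Prod>i = 1..n. fact (2 * i) ^ 4 / (fact (4 * i) * fact (4 * i + 1)))
        * (\<Prod>l = 0..n. pochhammer (of_nat r - of_nat l) (2 * l + 1))
        * (\<Prod>l\<in>{0..<n}. pochhammer (of_nat r + 1 / 2 - of_nat l) (2 * l + 1))
        * (\<Sum>i = 1..n + 1.
            (fact (2 * n + 2 * i) * fact (2 * n + 2 - 2 * i) * pochhammer (of_nat r + 1) (n + 1))
            / (fact (n + i) ^ 2 * fact (n + 1 - i) ^ 2 * (of_nat r + of_nat i))))"
  unfolding Let_def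
proof (intro conjI allI impI det_V_mat_closed_form)
  fix n :: nat
  \<comment> \<open>At \<open>x = 2r + 1\<close> the argument \<open>(x+1)/2\<close> is
    \<open>r + 1\<close>, where the Bernoulli values are power sums; \<open>r > n + 1\<close> avoids
    the zeros of the denominators on the right.\<close>
  let ?A = "(\<lambda>r. 2 * of_nat r + 1 :: rat) ` {n + 1<..}"
  have "infinite ?A"
    by (subst finite_image_iff) (auto intro: inj_onI simp: infinite_Ioi)
  then show "hankel_det n (\<lambda>k. bernpoly (2 * k + 5) ((ratfun_X + 1) / 2) / of_nat (2 * k + 5)) =
        1 / (5 * 2 ^ (n + 2))
        * (\<Prod>i = 1..n. (fact (2 * i + 3) ^ 2 * fact (2 * i + 2) ^ 2)
              / (fact (4 * i + 5) * fact (4 * i + 4)))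
        * (\<Prod>l = 0..n. pochhammer (ratfun_X - 2 * of_nat n - 1 + 2 * of_nat l) (4 * n - 4 * l + 3))
        * (\<Sum>i = 1..n + 2.
            ((2 * of_nat i - 1) * pochhammer (of_nat n + 5 / 2) (i - 1)
              * pochhammer (ratfun_X / 2 + 1 / 2) (n + 2)
              * pochhammer (ratfun_X / 2 - of_nat n - 3 / 2) (n + 2))
            / (pochhammer (of_nat n - of_nat i + 5 / 2) i * fact (n + 2 - i) * fact (n + 1 + i)
              * (ratfun_X ^ 2 - (2 * of_nat i - 1) ^ 2)))"
    (is "?L = ?R")
  proof (rule fract_eqI)
    fix x assume "x \<in> ?A"
    then obtain r where r: "r > n + 1" "x = 2 * of_nat r + 1" by auto
    note intros = fract_value_diff fract_value_power fract_value_mult fract_value_sum fract_value_divide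
        fract_value_fact fract_value_add fract_value_prod fract_value_pochhammer fract_value_of_nat
        fract_value_numeral fract_value_1 fract_value_X
    have "fract_value x ?L (hankel_det n (\<lambda>k. bernpoly (2 * k + 5) ((x + 1) / 2) / of_nat (2 * k + 5)))"
      by (intro fract_value_hankel_det fract_value_bernpoly intros) auto
    also have "(x + 1) / 2 = of_nat r + 1" by (simp add: r(2))
    also have "(\<lambda>k. bernpoly (2 * k + 5) (of_nat r + 1) / of_nat (2 * k + 5)) = (\<lambda>k. power_sum r (2 * k + 4))"
      by (rule ext) (rule bernpoly_eq_power_sum)
    also note hankel_det_power_sum_4_closed_form[OF r]
    finally have L: "fract_value x ?L
      (1 / (5 * 2 ^ (n + 2))
        * (\<Prod>i = 1..n. (fact (2 * i + 3) ^ 2 * fact (2 * i + 2) ^ 2)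
              / (fact (4 * i + 5) * fact (4 * i + 4)))
        * (\<Prod>l = 0..n. pochhammer (x - 2 * of_nat n - 1 + 2 * of_nat l) (4 * n - 4 * l + 3))
        * (\<Sum>i = 1..n + 2.
            ((2 * of_nat i - 1) * pochhammer (of_nat n + 5 / 2) (i - 1)
              * pochhammer (x / 2 + 1 / 2) (n + 2)
              * pochhammer (x / 2 - of_nat n - 3 / 2) (n + 2))
            / (pochhammer (of_nat n - of_nat i + 5 / 2) i * fact (n + 2 - i) * fact (n + 1 + i)
              * (x ^ 2 - (2 * of_nat i - 1) ^ 2))))" (is "fract_value x ?L ?v") .
    have nz: "pochhammer (of_nat n - of_nat i + 5 / 2) i * fact (n + 2 - i) * fact (n + 1 + i)
              * (x ^ 2 - (2 * of_nat i - 1) ^ 2) \<noteq> 0" if "i \<in> {1..n + 2}" for i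
    proof -
      have i: "1 \<le> i" "i \<le> n + 2" using that by auto
      have "of_nat i \<le> (of_nat (n + 2) :: rat)" using i by (simp only: of_nat_le_iff)
      then have "pochhammer (of_nat n - of_nat i + 5 / 2 :: rat) i \<noteq> 0"
        by (intro pochhammer_pos_rat_neq_0) simp
      moreover have "x ^ 2 - (2 * of_nat i - 1) ^ 2 = 4 * ((of_nat r + 1 - of_nat i) * (of_nat r + of_nat i))"
        by (simp add: r(2) power2_eq_square algebra_simps)
      moreover have "of_nat i < (of_nat r + 1 :: rat)"
        using i r(1) by (simp flip: of_nat_Suc add: add.commute)
      moreover have "(of_nat r + of_nat i :: rat) > 0" using i by (simp flip: of_nat_add)
      ultimately show ?thesis by simp
    qed
    have "fract_value x ?R ?v"
      using nz by (intro intros) auto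
    with L show "\<exists>v. fract_value x ?L v \<and> fract_value x ?R v" by blast
  qed
qed

end
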